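(* Let $g$ be the Kerr-(anti-)de Sitter metric with real parameters $a,\Lambda$ and $m\neq0$ (see context). Then the invariant $$Q_2=\frac1{27}\,\frac{I_5I_6-I_7^2}{(I_1^2+I_2^2)^{5/2}}$$ of $g$ equals $$Q_2=-\frac{a^2\sin^2\theta\left(\frac{r^4\Lambda}{3}+\left(-1+\frac{a^2\Lambda}{3}\right)r^2+2mr-a^2\right)\left(1+\frac{a^2\Lambda\cos^2\theta}{3}\right)}{(r^2+a^2\cos^2\theta)\,m^2}.$$
   Context: Kerr-(anti-)de Sitter metric (zero acceleration): in coordinates $(t,r,\theta,\phi)$, signature $(-,+,+,+)$, $$ds^2=-\frac{Q}{\rho^2}\big[dt-a\sin^2\theta\,d\phi\big]^2+\frac{\rho^2}{Q}dr^2+\frac{\rho^2}{P}d\theta^2+\frac{P}{\rho^2}\sin^2\theta\big[a\,dt-(r^2+a^2)d\phi\big]^2,$$ $\rho^2=r^2+a^2\cos^2\theta$, $P=1+\frac13\Lambda a^2\cos^2\theta$, $Q=a^2-2mr+r^2-\frac13\Lambda(a^2+r^2)r^2$, on the domain where the metric is regular ($\rho^2\ne0$, $Q\neq0$, $P>0$, $\sin\theta\neq0$). With $C_{\kappa\lambda\mu\nu}$ the Weyl tensor and $C^*_{\kappa\lambda\mu\nu}=\frac12E_{\kappa\lambda\sigma\tau}C^{\sigma\tau}{}_{\mu\nu}$ its dual ($E$ the Levi-Civita pseudotensor; $Q_2$ does not depend on orientation): $I_1=C_{\kappa\lambda\mu\nu}C^{\kappa\lambda\mu\nu}$, $I_2=C^*_{\kappa\lambda\mu\nu}C^{\kappa\lambda\mu\nu}$,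 $k_\mu=-\nabla_\mu I_1$, $l_\mu=-\nabla_\mu I_2$, $I_5=k_\mu k^\mu$, $I_6=l_\mu l^\mu$, $I_7=k_\mu l^\mu$. *)

theory Defs
  imports "HOL-Analysis.Analysis"
begin

text \<open>A metric in a coordinate chart is the function sending a point to its component matrix.
  A tensor field is given by its components as functions of the point, the point being the last
  argument.\<close>

type_synonym 'n metric = "real^'n \<Rightarrow> real^'n^'n"

definition partial_deriv :: "'n::finite \<Rightarrow> (real^'n \<Rightarrow> real) \<Rightarrow> real^'n \<Rightarrow> real" where
  "partial_deriv i f x = deriv (\<lambda>s. f (x + s *\<^sub>R axis i 1)) 0"

definition christoffel :: "'n::finite metric \<Rightarrow> 'n \<Rightarrow> 'n \<Rightarrow> 'n \<Rightarrow> real^'n \<Rightarrow> real" where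
  "christoffel g i j k x =
     (1/2) * (\<Sum>l\<in>UNIV. matrix_inv (g x) $ i $ l *
        (partial_deriv j (\<lambda>y. g y $ l $ k) x + partial_deriv k (\<lambda>y. g y $ l $ j) x
         - partial_deriv l (\<lambda>y. g y $ j $ k) x))"

text \<open>\<open>riemann_up g i j k l\<close> is \<open>R\<^sup>i\<^sub>j\<^sub>k\<^sub>l\<close>, where
  \<open>(\<nabla>\<^sub>k \<nabla>\<^sub>l - \<nabla>\<^sub>l \<nabla>\<^sub>k) V\<^sup>i = R\<^sup>i\<^sub>j\<^sub>k\<^sub>l V\<^sup>j\<close>.\<close>

definition riemann_up :: "'n::finite metric \<Rightarrow> 'n \<Rightarrow> 'n \<Rightarrow> 'n \<Rightarrow> 'n \<Rightarrow> real^'n \<Rightarrow> real" where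
  "riemann_up g i j k l x =
     partial_deriv k (christoffel g i l j) x - partial_deriv l (christoffel g i k j) x
     + (\<Sum>e\<in>UNIV. christoffel g i k e x * christoffel g e l j x
                 - christoffel g i l e x * christoffel g e k j x)"

definition riemann :: "'n::finite metric \<Rightarrow> 'n \<Rightarrow> 'n \<Rightarrow> 'n \<Rightarrow> 'n \<Rightarrow> real^'n \<Rightarrow> real" where
  "riemann g i j k l x = (\<Sum>e\<in>UNIV. g x $ i $ e * riemann_up g e j k l x)"

definition ricci :: "'n::finite metric \<Rightarrow> 'n \<Rightarrow> 'n \<Rightarrow> real^'n \<Rightarrow> real" where
  "ricci g j l x = (\<Sum>i\<in>UNIV. riemann_up g i j i l x)"

definition scalar_curvature :: "'n::finite metric \<Rightarrow> real^'n \<Rightarrow> real" where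
  "scalar_curvature g x = (\<Sum>j\<in>UNIV. \<Sum>l\<in>UNIV. matrix_inv (g x) $ j $ l * ricci g j l x)"

text \<open>The formula presupposes dimension at least 3.\<close>

definition weyl :: "'n::finite metric \<Rightarrow> 'n \<Rightarrow> 'n \<Rightarrow> 'n \<Rightarrow> 'n \<Rightarrow> real^'n \<Rightarrow> real" where
  "weyl g i j k l x =
     riemann g i j k l x
     - (g x $ i $ k * ricci g j l x - g x $ i $ l * ricci g j k x
        + g x $ j $ l * ricci g i k x - g x $ j $ k * ricci g i l x) / (real CARD('n) - 2)
     + scalar_curvature g x * (g x $ i $ k * g x $ j $ l - g x $ i $ l * g x $ j $ k)
         / ((real CARD('n) - 1) * (real CARD('n) - 2))"

definition levi_civita_symbol :: "('n::finite \<Rightarrow> 'n) \<Rightarrow> real" where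
  "levi_civita_symbol p = (if p permutes UNIV then of_int (sign p) else 0)"

text \<open>The chart is taken to be positively oriented.\<close>

definition levi_civita :: "4 metric \<Rightarrow> 4 \<Rightarrow> 4 \<Rightarrow> 4 \<Rightarrow> 4 \<Rightarrow> real^4 \<Rightarrow> real" where
  "levi_civita g i j k l x =
     sqrt \<bar>det (g x)\<bar> * levi_civita_symbol (($) (vector [i, j, k, l] :: 4^4))"

definition weyl_dual :: "4 metric \<Rightarrow> 4 \<Rightarrow> 4 \<Rightarrow> 4 \<Rightarrow> 4 \<Rightarrow> real^4 \<Rightarrow> real" where
  "weyl_dual g i j k l x =
     (1/2) * (\<Sum>s\<in>UNIV. \<Sum>u\<in>UNIV. levi_civita g i j s u x *
        (\<Sum>p\<in>UNIV. \<Sum>q\<in>UNIV.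
           matrix_inv (g x) $ s $ p * matrix_inv (g x) $ u $ q * weyl g p q k l x))"

definition weyl_up :: "'n::finite metric \<Rightarrow> 'n \<Rightarrow> 'n \<Rightarrow> 'n \<Rightarrow> 'n \<Rightarrow> real^'n \<Rightarrow> real" where
  "weyl_up g i j k l x =
     (\<Sum>p\<in>UNIV. \<Sum>q\<in>UNIV. \<Sum>s\<in>UNIV. \<Sum>u\<in>UNIV.
        matrix_inv (g x) $ i $ p * matrix_inv (g x) $ j $ q *
        matrix_inv (g x) $ k $ s * matrix_inv (g x) $ l $ u * weyl g p q s u x)"

definition inv_I1 :: "4 metric \<Rightarrow> real^4 \<Rightarrow> real" where
  "inv_I1 g x = (\<Sum>i\<in>UNIV. \<Sum>j\<in>UNIV. \<Sum>k\<in>UNIV. \<Sum>l\<in>UNIV.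
     weyl g i j k l x * weyl_up g i j k l x)"

definition inv_I2 :: "4 metric \<Rightarrow> real^4 \<Rightarrow> real" where
  "inv_I2 g x = (\<Sum>i\<in>UNIV. \<Sum>j\<in>UNIV. \<Sum>k\<in>UNIV. \<Sum>l\<in>UNIV.
     weyl_dual g i j k l x * weyl_up g i j k l x)"

text \<open>On scalars the covariant derivative is the partial derivative.\<close>

definition covec_k :: "4 metric \<Rightarrow> 4 \<Rightarrow> real^4 \<Rightarrow> real" where
  "covec_k g i x = - partial_deriv i (inv_I1 g) x"

definition covec_l :: "4 metric \<Rightarrow> 4 \<Rightarrow> real^4 \<Rightarrow> real" where
  "covec_l g i x = - partial_deriv i (inv_I2 g) x"

definition covec_inner ::
    "'n::finite metric \<Rightarrow> ('n \<Rightarrow> real^'n \<Rightarrow> real) \<Rightarrow> ('n \<Rightarrow> real^'n \<Rightarrow> real) \<Rightarrow> real^'n \<Rightarrow> real" where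
  "covec_inner g v w x = (\<Sum>i\<in>UNIV. \<Sum>j\<in>UNIV. matrix_inv (g x) $ i $ j * v i x * w j x)"

definition inv_I5 :: "4 metric \<Rightarrow> real^4 \<Rightarrow> real" where
  "inv_I5 g = covec_inner g (covec_k g) (covec_k g)"

definition inv_I6 :: "4 metric \<Rightarrow> real^4 \<Rightarrow> real" where
  "inv_I6 g = covec_inner g (covec_l g) (covec_l g)"

definition inv_I7 :: "4 metric \<Rightarrow> real^4 \<Rightarrow> real" where
  "inv_I7 g = covec_inner g (covec_k g) (covec_l g)"

definition inv_Q2 :: "4 metric \<Rightarrow> real^4 \<Rightarrow> real" where
  "inv_Q2 g x = (1/27) * ((inv_I5 g x * inv_I6 g x - (inv_I7 g x)\<^sup>2)
                          / ((inv_I1 g x)\<^sup>2 + (inv_I2 g x)\<^sup>2) powr (5/2))"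

definition kerr_rho2 :: "real \<Rightarrow> real \<Rightarrow> real \<Rightarrow> real" where
  "kerr_rho2 a r \<theta> = r\<^sup>2 + a\<^sup>2 * (cos \<theta>)\<^sup>2"

definition kerr_P :: "real \<Rightarrow> real \<Rightarrow> real \<Rightarrow> real" where
  "kerr_P a \<Lambda> \<theta> = 1 + (1/3) * \<Lambda> * a\<^sup>2 * (cos \<theta>)\<^sup>2"

definition kerr_Q :: "real \<Rightarrow> real \<Rightarrow> real \<Rightarrow> real \<Rightarrow> real" where
  "kerr_Q a \<Lambda> m r = a\<^sup>2 - 2 * m * r + r\<^sup>2 - (1/3) * \<Lambda> * (a\<^sup>2 + r\<^sup>2) * r\<^sup>2"

text \<open>The coordinates \<open>(t, r, \<theta>, \<phi>)\<close> are the components 1, 2, 3, 4 of the point (in the index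
  type \<^typ>\<open>4\<close>, the numeral 4 is the element 0).\<close>

definition kerr_ds_metric :: "real \<Rightarrow> real \<Rightarrow> real \<Rightarrow> 4 metric" where
  "kerr_ds_metric a \<Lambda> m x =
     (let r = x $ 2; \<theta> = x $ 3;
          dt = axis 1 1; dr = axis 2 1; d\<theta> = axis 3 1; d\<phi> = axis 4 1;
          \<rho>2 = kerr_rho2 a r \<theta>; P = kerr_P a \<Lambda> \<theta>; Q = kerr_Q a \<Lambda> m r;
          \<alpha> = dt - (a * (sin \<theta>)\<^sup>2) *\<^sub>R d\<phi>;
          \<beta> = a *\<^sub>R dt - (r\<^sup>2 + a\<^sup>2) *\<^sub>R d\<phi>
      in \<chi> i j. - (Q / \<rho>2) * (\<alpha> $ i * \<alpha> $ j)
               + (\<rho>2 / Q) * (dr $ i * dr $ j)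
               + (\<rho>2 / P) * (d\<theta> $ i * d\<theta> $ j)
               + (P / \<rho>2) * (sin \<theta>)\<^sup>2 * (\<beta> $ i * \<beta> $ j))"

end

theory Submission
  imports Defs
begin

text \<open>The metric is diagonal in the frame \<open>\<alpha> = dt - a sin\<^sup>2\<theta> d\<phi>\<close>, \<open>dr\<close>, \<open>d(cos \<theta>)\<close>,
  \<open>\<beta> = a dt - (r\<^sup>2 + a\<^sup>2) d\<phi>\<close>, and with \<open>x = cos \<theta>\<close> all squared norms and connection coefficients of
  this frame are rational in \<open>r\<close> and \<open>x\<close>. The curvature in the frame is \<open>\<Lambda>/3\<close> times that of constant
  curvature plus a trace-free tensor of Petrov type D, depending only on the real and imaginary parts of
  \<open>\<Psi> = m/(r - i a x)\<^sup>3\<close>. Hence \<open>I\<^sub>1\<close> and \<open>I\<^sub>2\<close> are, up to sign, the real and imaginary parts of \<open>48 \<Psi>\<^sup>2\<close>,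
  and the Gram determinant \<open>I\<^sub>5 I\<^sub>6 - I\<^sub>7\<^sup>2\<close> of their gradients follows from the Cauchy-Riemann equations
  for \<open>\<Psi>\<close> in the variable \<open>r - i a x\<close>.\<close>

subsection \<open>Partial derivatives\<close>

text \<open>In coordinates the Christoffel symbols and their derivatives are large expressions in
  rational and trigonometric functions, and an orthonormal frame would need the square root of the
  absolute value of Q, hence cases on the sign of \<open>kerr_Q\<close>. Keeping the squared norms
  as weights leaves everything rational and covers both signs at once. The weights pair up: those of
  \<alpha> and dr multiply to -1, those of d(cos \<theta>) and \<beta> to 1, so they cancel from the
  scalars built from the Weyl tensor. The connection coefficients are not derived but tabulated and
  certified: the torsion-free metric connection is unique, so checking the structure equations is
  enough. What remains are polynomial identities modulo the relations that define the inverses,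
  which \<open>algebra\<close> decides. The sign of sin \<theta> decides whether the frame is
  positively oriented and hence the sign of I_2. It is held fixed on an open domain, so that I_2 can
  be differentiated there, and it enters Q_2 only squared. The exponent 5/2 acts on a perfect
  square, and the factor 1/27 absorbs all numerical constants.\<close>

definition has_partial :: "'n::finite \<Rightarrow> (real^'n \<Rightarrow> real) \<Rightarrow> real \<Rightarrow> real^'n \<Rightarrow> bool" where
  "has_partial i f d x \<longleftrightarrow> ((\<lambda>s. f (x + s *\<^sub>R axis i 1)) has_real_derivative d) (at 0)"

lemma has_partial_imp_partial_deriv: "has_partial i f d x \<Longrightarrow> partial_deriv i f x = d"
  unfolding has_partial_def partial_deriv_def by (rule DERIV_imp_deriv)

text \<open>\<open>partial_deriv\<close> has an unspecified value where no derivative exists, so the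
  calculus rules are stated for the relation. This lemma returns to the function once
  differentiability is known.\<close>

lemma has_partial_partial_deriv:
  "has_partial i f d x \<Longrightarrow> has_partial i f (partial_deriv i f x) x"
  by (frule has_partial_imp_partial_deriv) simp

lemma has_partial_unique: "has_partial i f d x \<Longrightarrow> has_partial i f d' x \<Longrightarrow> d = d'"
  using has_partial_imp_partial_deriv by metis

lemma has_partial_const: "has_partial i (\<lambda>y. c) 0 x"
  by (simp add: has_partial_def)

lemma has_partial_add:
  "has_partial i f d x \<Longrightarrow> has_partial i f' d' x \<Longrightarrow> has_partial i (\<lambda>y. f y + f' y) (d + d') x"
  unfolding has_partial_def by (rule DERIV_add)

lemma has_partial_mult:
  "has_partial i f d x \<Longrightarrow> has_partial i f' d' x \<Longrightarrow>
   has_partial i (\<lambda>y. f y * f' y) (d * f' x + f x * d') x"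
  unfolding has_partial_def by (auto intro!: derivative_eq_intros)

lemma has_partial_sum:
  "(\<And>k. has_partial i (f k) (d k) x) \<Longrightarrow> has_partial i (\<lambda>y. \<Sum>k\<in>A. f k y) (\<Sum>k\<in>A. d k) x"
  unfolding has_partial_def by (rule DERIV_sum) auto

lemma has_partial_eqI: "has_partial i f d x \<Longrightarrow> d = d' \<Longrightarrow> has_partial i f d' x"
  by simp

lemma has_partial_diff:
  "has_partial i f d x \<Longrightarrow> has_partial i f' d' x \<Longrightarrow> has_partial i (\<lambda>y. f y - f' y) (d - d') x"
  unfolding has_partial_def by (rule DERIV_diff)

lemma has_partial_minus: "has_partial i f d x \<Longrightarrow> has_partial i (\<lambda>y. - f y) (- d) x"
  unfolding has_partial_def by (rule DERIV_minus)

lemma has_partial_compose: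
  "(F has_real_derivative D) (at (f x)) \<Longrightarrow> has_partial i f d x \<Longrightarrow> has_partial i (\<lambda>y. F (f y)) (D * d) x"
  unfolding has_partial_def by (rule DERIV_chain2) auto

lemma has_partial_power2: "has_partial i f d x \<Longrightarrow> has_partial i (\<lambda>y. (f y)\<^sup>2) (2 * f x * d) x"
  by (rule has_partial_compose[where F = "\<lambda>z. z\<^sup>2"]) (auto intro!: derivative_eq_intros)

lemma has_partial_inverse:
  "has_partial i f d x \<Longrightarrow> f x \<noteq> 0 \<Longrightarrow> has_partial i (\<lambda>y. inverse (f y)) (- (inverse (f x))\<^sup>2 * d) x"
  by (rule has_partial_compose[where F = inverse]) (auto intro!: derivative_eq_intros simp: power2_eq_square)

lemma has_partial_coord: "has_partial i (\<lambda>y. y $ j) (if i = j then 1 else 0) x"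
  unfolding has_partial_def by (auto intro!: derivative_eq_intros simp: axis_def)

lemma has_partial_power: "has_partial i f d x \<Longrightarrow> has_partial i (\<lambda>y. f y ^ n) (of_nat n * f x ^ (n - 1) * d) x"
  by (rule has_partial_compose[where F = "\<lambda>z. z ^ n"]) (auto intro!: derivative_eq_intros)

lemma has_partial_if:
  "has_partial i f d x \<Longrightarrow> has_partial i (\<lambda>y. if P then f y else 0) (if P then d else 0) x"
  by (simp add: has_partial_const)

lemma has_partial_sin: "has_partial k (\<lambda>y::real^4. sin (y$3)) (if k = 3 then cos (y$3) else 0) y"
  by (rule has_partial_eqI, rule has_partial_compose[where F = sin], rule DERIV_sin, rule has_partial_coord) simp

lemma has_partial_cos: "has_partial k (\<lambda>y::real^4. cos (y$3)) (if k = 3 then - sin (y$3) else 0) y"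
  by (rule has_partial_eqI, rule has_partial_compose[where F = cos], rule DERIV_cos, rule has_partial_coord) simp

lemmas has_partial_intros = has_partial_const has_partial_add has_partial_diff has_partial_minus
  has_partial_mult has_partial_power2

text \<open>The coordinate line through \<open>x\<close> stays in \<open>U\<close> for small
  parameters. Needed because all closed formulas hold on an open domain only, yet have to be
  differentiated.\<close>

lemma has_partial_cong_open:
  assumes "open U" "x \<in> U" "\<And>y. y \<in> U \<Longrightarrow> f y = f' y"
  shows "has_partial i f d x \<longleftrightarrow> has_partial i f' d x"
proof -
  have "((\<lambda>s. x + s *\<^sub>R axis i 1) \<longlongrightarrow> x + 0 *\<^sub>R axis i (1::real)) (at 0)"
    by (intro tendsto_intros)
  then have "\<forall>\<^sub>F s in at 0. x + s *\<^sub>R axis i 1 \<in> U"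
    using assms(1,2) by (simp add: topological_tendstoD)
  then have "\<forall>\<^sub>F s in nhds 0. x + s *\<^sub>R axis i 1 \<in> U"
    using assms(2) by (auto simp: eventually_at_filter elim!: eventually_mono)
  then have "\<forall>\<^sub>F s in nhds 0. f (x + s *\<^sub>R axis i 1) = f' (x + s *\<^sub>R axis i 1)"
    by (rule eventually_mono) (use assms(3) in auto)
  then show ?thesis
    unfolding has_partial_def by (intro DERIV_cong_ev) auto
qed

lemma partial_deriv_cong_open:
  assumes "open U" "x \<in> U" "\<And>y. y \<in> U \<Longrightarrow> f y = f' y"
  shows "partial_deriv i f x = partial_deriv i f' x"
  using has_partial_cong_open[of U x f f' i, OF assms] by (simp add: partial_deriv_def deriv_def has_partial_def)

subsection \<open>Curvature in an orthogonal moving frame\<close>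

text \<open>\<open>matrix_inv\<close> is a choice; a one-sided inverse of a square matrix is
  two-sided, and this makes the choice unique.\<close>

lemma matrix_inv_eqI:
  fixes A B :: "real^'n^'n"
  assumes "A ** B = mat 1"
  shows "matrix_inv A = B"
proof -
  have "A ** matrix_inv A = mat 1 \<and> matrix_inv A ** A = mat 1"
    unfolding matrix_inv_def by (rule someI[of _ B]) (use assms matrix_left_right_inverse in blast)
  then show ?thesis
    by (metis assms matrix_mul_assoc matrix_mul_lid matrix_mul_rid)
qed

text \<open>Uniqueness of the Levi-Civita connection, pointwise. It allows coefficients to be
  guessed and verified instead of computed from the metric.\<close>

lemma christoffel_eqI:
  fixes g :: "'n::finite metric" and \<Gamma> :: "'n \<Rightarrow> 'n \<Rightarrow> 'n \<Rightarrow> real" and G :: "real^'n^'n"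
  assumes inv: "g x ** G = mat 1"
    and sym: "\<And>i j. g x $ i $ j = g x $ j $ i"
    and torsion_free: "\<And>i j k. \<Gamma> i j k = \<Gamma> i k j"
    and compatible: "\<And>i j k. partial_deriv k (\<lambda>y. g y $ i $ j) x =
      (\<Sum>e\<in>UNIV. g x $ i $ e * \<Gamma> e k j) + (\<Sum>e\<in>UNIV. g x $ j $ e * \<Gamma> e k i)"
  shows "christoffel g i j k x = \<Gamma> i j k"
proof -
  define L where "L l j k = (\<Sum>e\<in>UNIV. g x $ l $ e * \<Gamma> e j k)" for l j k
  have Lsym: "L l j k = L l k j" for l j k
    unfolding L_def by (metis torsion_free)
  have "G ** g x = mat 1"
    using inv matrix_left_right_inverse by blast
  then have Gg: "(\<Sum>l\<in>UNIV. G $ i $ l * g x $ l $ e) = (if i = e then 1 else 0)" for e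
    by (simp add: matrix_matrix_mult_def mat_def vec_eq_iff)
  \<comment> \<open>Compatibility turns the three partial derivatives into six terms
    \<open>L\<close>; by symmetry four of them cancel and the other two agree.\<close>
  have "christoffel g i j k x = (1/2) * (\<Sum>l\<in>UNIV. G $ i $ l * (2 * L l j k))"
    unfolding christoffel_def matrix_inv_eqI[OF inv] compatible L_def[symmetric]
    by (intro arg_cong[where f="(*) (1/2)"] sum.cong refl) (use Lsym in simp)
  also have "\<dots> = (\<Sum>l\<in>UNIV. G $ i $ l * L l j k)"
    by (simp add: sum_distrib_left mult.left_commute)
  also have "\<dots> = (\<Sum>e\<in>UNIV. (\<Sum>l\<in>UNIV. G $ i $ l * g x $ l $ e) * \<Gamma> e j k)"
    unfolding L_def sum_distrib_left sum_distrib_right by (subst sum.swap) (simp add: mult.assoc)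
  also have "\<dots> = \<Gamma> i j k"
    unfolding Gg by (simp add: if_distrib[of "\<lambda>z. z * _"] cong: if_cong)
  finally show ?thesis .
qed

text \<open>An orthogonal, not necessarily normalised, moving frame: \<open>e A\<close> are the covectors, \<open>E _ A\<close>
  the dual vectors, \<open>h A\<close> the squared frame_norms, and \<open>\<gamma> A B C\<close> the components of the connection form
  \<open>\<omega>\<^sup>A\<^sub>B\<close> along \<open>e C\<close>.\<close>

locale moving_frame =
  fixes U :: "(real^'n::finite) set" and g :: "'n metric"
    and e E :: "'n \<Rightarrow> 'n \<Rightarrow> real^'n \<Rightarrow> real" and h :: "'n \<Rightarrow> real^'n \<Rightarrow> real"
    and \<gamma> :: "'n \<Rightarrow> 'n \<Rightarrow> 'n \<Rightarrow> real^'n \<Rightarrow> real" and d\<gamma> :: "'n \<Rightarrow> 'n \<Rightarrow> 'n \<Rightarrow> 'n \<Rightarrow> real^'n \<Rightarrow> real"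
    and de :: "'n \<Rightarrow> 'n \<Rightarrow> 'n \<Rightarrow> real^'n \<Rightarrow> real" and dde :: "'n \<Rightarrow> 'n \<Rightarrow> 'n \<Rightarrow> 'n \<Rightarrow> real^'n \<Rightarrow> real"
  assumes open_domain: "open U"
    and metric: "x \<in> U \<Longrightarrow> g x $ i $ j = (\<Sum>A\<in>UNIV. h A x * e A i x * e A j x)"
    and h_nonzero: "x \<in> U \<Longrightarrow> h A x \<noteq> 0"
    and dual: "x \<in> U \<Longrightarrow> (\<Sum>A\<in>UNIV. E i A x * e A j x) = (if i = j then 1 else 0)"
    and dual': "x \<in> U \<Longrightarrow> (\<Sum>i\<in>UNIV. e A i x * E i B x) = (if A = B then 1 else 0)"
    and E_partial: "x \<in> U \<Longrightarrow> \<exists>d. has_partial k (E i A) d x"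
    and e_partial: "x \<in> U \<Longrightarrow> has_partial k (e A i) (de A i k x) x"
    and de_partial: "x \<in> U \<Longrightarrow> has_partial l (de A i k) (dde A i k l x) x"
    and dde_commute: "x \<in> U \<Longrightarrow> dde A i k l x = dde A i l k x"
    and h_partial: "x \<in> U \<Longrightarrow>
      has_partial k (h A) (2 * h A x * (\<Sum>C\<in>UNIV. \<gamma> A A C x * e C k x)) x"
    and skew: "x \<in> U \<Longrightarrow> A \<noteq> B \<Longrightarrow> h A x * \<gamma> A B C x = - (h B x * \<gamma> B A C x)"
    and torsion: "x \<in> U \<Longrightarrow> de A l k x - de A k l x =
      (\<Sum>B\<in>UNIV. \<Sum>C\<in>UNIV. (\<gamma> A B C x - \<gamma> A C B x) * e B k x * e C l x)"
    and \<gamma>_partial: "x \<in> U \<Longrightarrow> has_partial k (\<gamma> A B C) (\<Sum>D\<in>UNIV. d\<gamma> A B C D x * e D k x) x"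
begin

definition \<omega> :: "'n \<Rightarrow> 'n \<Rightarrow> 'n \<Rightarrow> real^'n \<Rightarrow> real" where
  "\<omega> A B k x = (\<Sum>C\<in>UNIV. \<gamma> A B C x * e C k x)"

text \<open>The value that the contraction of \<open>e A\<close> with the Christoffel symbols must
  have, since the covariant derivative of \<open>e A\<close> is minus the connection form applied to
  the frame.\<close>

definition De :: "'n \<Rightarrow> 'n \<Rightarrow> 'n \<Rightarrow> real^'n \<Rightarrow> real" where
  "De A k j x = de A j k x + (\<Sum>B\<in>UNIV. \<omega> A B k x * e B j x)"

definition \<Gamma> :: "'n \<Rightarrow> 'n \<Rightarrow> 'n \<Rightarrow> real^'n \<Rightarrow> real" where
  "\<Gamma> i k j x = (\<Sum>A\<in>UNIV. E i A x * De A k j x)"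

text \<open>Cartan's second structure equation d\<omega> + \<omega> \<and> \<omega> in frame
  components. The first sum arises from the exterior derivatives of the covectors, which the first
  structure equation expresses by \<open>\<gamma>\<close>.\<close>

definition curvature :: "'n \<Rightarrow> 'n \<Rightarrow> 'n \<Rightarrow> 'n \<Rightarrow> real^'n \<Rightarrow> real" where
  "curvature A B C D x = d\<gamma> A B D C x - d\<gamma> A B C D x
     + (\<Sum>F\<in>UNIV. \<gamma> A B F x * (\<gamma> F C D x - \<gamma> F D C x))
     + (\<Sum>F\<in>UNIV. \<gamma> A F C x * \<gamma> F B D x - \<gamma> A F D x * \<gamma> F B C x)"

lemma frame_contract:
  assumes "x \<in> U"
  shows "(\<Sum>i\<in>UNIV. e A i x * (\<Sum>B\<in>UNIV. E i B x * f B)) = f A"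
proof -
  have "(\<Sum>i\<in>UNIV. e A i x * (\<Sum>B\<in>UNIV. E i B x * f B))
      = (\<Sum>B\<in>UNIV. (\<Sum>i\<in>UNIV. e A i x * E i B x) * f B)"
    unfolding sum_distrib_left sum_distrib_right by (subst sum.swap) (simp add: mult.assoc)
  then show ?thesis
    by (simp add: dual'[OF assms] if_distrib[of "\<lambda>z. z * _"] cong: if_cong)
qed

lemma frame_contract':
  assumes "x \<in> U"
  shows "(\<Sum>A\<in>UNIV. E i A x * (\<Sum>j\<in>UNIV. e A j x * f j)) = f i"
proof -
  have "(\<Sum>A\<in>UNIV. E i A x * (\<Sum>j\<in>UNIV. e A j x * f j))
      = (\<Sum>j\<in>UNIV. (\<Sum>A\<in>UNIV. E i A x * e A j x) * f j)"
    unfolding sum_distrib_left sum_distrib_right by (subst sum.swap) (simp add: mult.assoc)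
  then show ?thesis
    by (simp add: dual[OF assms] if_distrib[of "\<lambda>z. z * _"] cong: if_cong)
qed

lemma metric_contract:
  assumes "x \<in> U"
  shows "(\<Sum>j\<in>UNIV. g x $ i $ j * f j) = (\<Sum>A\<in>UNIV. h A x * e A i x * (\<Sum>j\<in>UNIV. e A j x * f j))"
  unfolding metric[OF assms] sum_distrib_left sum_distrib_right
  by (subst sum.swap) (simp add: mult.assoc)

lemma metric_inverse:
  assumes "x \<in> U"
  shows "g x ** (\<chi> i j. \<Sum>A\<in>UNIV. E i A x * E j A x / h A x) = mat 1"
proof -
  have "(\<Sum>k\<in>UNIV. g x $ i $ k * (\<Sum>A\<in>UNIV. E k A x * E j A x / h A x)) = (if i = j then 1 else 0)" for i j
  proof -
    have "(\<Sum>k\<in>UNIV. g x $ i $ k * (\<Sum>A\<in>UNIV. E k A x * E j A x / h A x))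
      = (\<Sum>A\<in>UNIV. h A x * e A i x * (E j A x / h A x))"
      using frame_contract[OF assms, of _ "\<lambda>A. E j A x / h A x"]
      by (simp add: metric_contract[OF assms])
    also have "\<dots> = (\<Sum>A\<in>UNIV. E j A x * e A i x)"
      using h_nonzero[OF assms] by (intro sum.cong) auto
    finally show ?thesis
      using dual[OF assms, of j i] by auto
  qed
  then show ?thesis
    by (simp add: matrix_matrix_mult_def mat_def vec_eq_iff)
qed

lemma matrix_inv_metric:
  "x \<in> U \<Longrightarrow> matrix_inv (g x) $ i $ j = (\<Sum>A\<in>UNIV. E i A x * E j A x / h A x)"
  using matrix_inv_eqI[OF metric_inverse] by simp

text \<open>This is the first structure equation: vanishing torsion is symmetry of \<open>De\<close>
  in its coordinate indices.\<close>

lemma De_commute: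
  assumes "x \<in> U"
  shows "De A k l x = De A l k x"
proof -
  have "(\<Sum>B\<in>UNIV. \<omega> A B k x * e B l x) = (\<Sum>B\<in>UNIV. \<Sum>C\<in>UNIV. \<gamma> A C B x * e B k x * e C l x)" for k l
    unfolding \<omega>_def sum_distrib_right by (rule sum.swap)
  moreover have "(\<Sum>B\<in>UNIV. \<omega> A B l x * e B k x) = (\<Sum>B\<in>UNIV. \<Sum>C\<in>UNIV. \<gamma> A B C x * e B k x * e C l x)" for k l
    unfolding \<omega>_def sum_distrib_right by (simp add: mult_ac)
  ultimately show ?thesis
    using torsion[OF assms, of A l k]
    by (simp add: De_def left_diff_distrib sum_subtractf)
qed

text \<open>The frame is not normalised, so the connection form has a diagonal part, one half of the
  logarithmic derivative of \<open>h A\<close>; only its off-diagonal part is skew with respect to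
  \<open>h\<close>.\<close>

lemma \<omega>_skew:
  assumes "x \<in> U"
  shows "h A x * \<omega> A B k x + h B x * \<omega> B A k x = (if A = B then 2 * h A x * \<omega> A A k x else 0)"
proof (cases "A = B")
  case False
  have "h A x * \<omega> A B k x = - (h B x * \<omega> B A k x)"
    unfolding \<omega>_def sum_distrib_left sum_negf[symmetric]
    by (intro sum.cong refl) (simp add: skew[OF assms False] mult.assoc[symmetric])
  with False show ?thesis by simp
qed simp

lemma christoffel_frame:
  assumes x: "x \<in> U"
  shows "christoffel g i j k x = \<Gamma> i j k x"
proof (rule christoffel_eqI)
  show "g x ** (\<chi> i j. \<Sum>A\<in>UNIV. E i A x * E j A x / h A x) = mat 1"
    by (rule metric_inverse[OF x])
  show "g x $ i $ j = g x $ j $ i" for i j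
    by (simp add: metric[OF x] mult_ac)
  show "\<Gamma> i j k x = \<Gamma> i k j x" for i j k
    unfolding \<Gamma>_def by (simp add: De_commute[OF x, of _ j k])
  fix i j k
  have lower: "(\<Sum>l\<in>UNIV. g x $ i $ l * \<Gamma> l k j x) = (\<Sum>A\<in>UNIV. h A x * e A i x * De A k j x)" for i j
    unfolding \<Gamma>_def by (simp add: metric_contract[OF x] frame_contract[OF x])
  have "has_partial k (\<lambda>y. \<Sum>A\<in>UNIV. h A y * e A i y * e A j y)
      (\<Sum>A\<in>UNIV. (2 * h A x * \<omega> A A k x * e A i x + h A x * de A i k x) * e A j x
         + h A x * e A i x * de A j k x) x"
    unfolding \<omega>_def
    by (intro has_partial_sum has_partial_mult h_partial e_partial x)
  then have "has_partial k (\<lambda>y. g y $ i $ j)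
      (\<Sum>A\<in>UNIV. (2 * h A x * \<omega> A A k x * e A i x + h A x * de A i k x) * e A j x
         + h A x * e A i x * de A j k x) x"
    by (subst has_partial_cong_open[OF open_domain x metric])
  then have "partial_deriv k (\<lambda>y. g y $ i $ j) x =
      (\<Sum>A\<in>UNIV. (2 * h A x * \<omega> A A k x * e A i x + h A x * de A i k x) * e A j x
         + h A x * e A i x * de A j k x)"
    by (rule has_partial_imp_partial_deriv)
  also have "\<dots> = (\<Sum>A\<in>UNIV. 2 * h A x * \<omega> A A k x * e A i x * e A j x)
      + (\<Sum>A\<in>UNIV. h A x * (de A i k x * e A j x + e A i x * de A j k x))"
    unfolding sum.distrib[symmetric] by (intro sum.cong refl) (simp add: algebra_simps)
  \<comment> \<open>By \<open>\<omega>_skew\<close> the off-diagonal terms of the double sum vanish.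
    Written in this symmetric form, it splits into the two halves that compatibility asks
    for.\<close>
  also have "(\<Sum>A\<in>UNIV. 2 * h A x * \<omega> A A k x * e A i x * e A j x)
      = (\<Sum>A\<in>UNIV. \<Sum>B\<in>UNIV. (h A x * \<omega> A B k x + h B x * \<omega> B A k x) * e A i x * e B j x)"
    unfolding \<omega>_skew[OF x] by (simp add: if_distrib[of "\<lambda>z. z * _"] cong: if_cong)
  also have "\<dots> = (\<Sum>A\<in>UNIV. \<Sum>B\<in>UNIV. h A x * e A i x * (\<omega> A B k x * e B j x))
      + (\<Sum>A\<in>UNIV. \<Sum>B\<in>UNIV. h B x * e B j x * (\<omega> B A k x * e A i x))"
    unfolding sum.distrib[symmetric] by (intro sum.cong refl) (simp add: algebra_simps)
  also have "(\<Sum>A\<in>UNIV. \<Sum>B\<in>UNIV. h B x * e B j x * (\<omega> B A k x * e A i x))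
      = (\<Sum>A\<in>UNIV. \<Sum>B\<in>UNIV. h A x * e A j x * (\<omega> A B k x * e B i x))"
    by (rule sum.swap)
  finally show "partial_deriv k (\<lambda>y. g y $ i $ j) x =
      (\<Sum>l\<in>UNIV. g x $ i $ l * \<Gamma> l k j x) + (\<Sum>l\<in>UNIV. g x $ j $ l * \<Gamma> l k i x)"
    unfolding lower De_def distrib_left sum.distrib sum_distrib_left by (simp add: mult_ac)
qed

lemma \<omega>_partial:
  assumes x: "x \<in> U"
  shows "has_partial l (\<omega> A B k)
    (\<Sum>C\<in>UNIV. (\<Sum>D\<in>UNIV. d\<gamma> A B C D x * e D l x) * e C k x + \<gamma> A B C x * de C k l x) x"
  unfolding \<omega>_def by (intro has_partial_sum has_partial_mult \<gamma>_partial e_partial x)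

lemma E_partial':
  assumes x: "x \<in> U"
  shows "has_partial k (E i A) (partial_deriv k (E i A) x) x"
proof -
  obtain d where "has_partial k (E i A) d x"
    using E_partial[OF x] ..
  then show ?thesis by (rule has_partial_partial_deriv)
qed

lemma De_partial:
  assumes x: "x \<in> U"
  shows "has_partial l (De A k j) (dde A j k l x +
    (\<Sum>B\<in>UNIV. partial_deriv l (\<omega> A B k) x * e B j x + \<omega> A B k x * de B j l x)) x"
  unfolding De_def
  by (intro has_partial_sum has_partial_mult has_partial_add e_partial[OF x] de_partial[OF x]
      has_partial_partial_deriv[OF \<omega>_partial[OF x]])

lemma \<Gamma>_partial:
  assumes x: "x \<in> U"
  shows "has_partial l (\<Gamma> i k j) (partial_deriv l (\<Gamma> i k j) x) x"
  unfolding \<Gamma>_def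
  by (rule has_partial_partial_deriv, rule has_partial_sum,
      rule has_partial_mult[OF E_partial'[OF x] De_partial[OF x]])

text \<open>Differentiating \<open>\<omega>\<close> hits both the coefficients and the covectors. In
  the antisymmetrised result the derivatives of the covectors occur only as torsion, which is again
  quadratic in the frame.\<close>

lemma curvature_form:
  assumes x: "x \<in> U"
  shows "partial_deriv k (\<omega> A B l) x - partial_deriv l (\<omega> A B k) x
      + (\<Sum>C\<in>UNIV. \<omega> A C k x * \<omega> C B l x - \<omega> A C l x * \<omega> C B k x)
    = (\<Sum>C\<in>UNIV. \<Sum>D\<in>UNIV. curvature A B C D x * e C k x * e D l x)"
proof -
  have d: "partial_deriv l (\<omega> A B k) x = (\<Sum>C\<in>UNIV. \<Sum>D\<in>UNIV. d\<gamma> A B C D x * e C k x * e D l x)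
     + (\<Sum>F\<in>UNIV. \<gamma> A B F x * de F k l x)" for k l
    unfolding has_partial_imp_partial_deriv[OF \<omega>_partial[OF x]] sum.distrib sum_distrib_right
    by (simp add: mult_ac)
  have d': "partial_deriv k (\<omega> A B l) x = (\<Sum>C\<in>UNIV. \<Sum>D\<in>UNIV. d\<gamma> A B D C x * e C k x * e D l x)
     + (\<Sum>F\<in>UNIV. \<gamma> A B F x * de F l k x)"
    unfolding d by (subst sum.swap) (simp add: mult_ac)
  have t: "(\<Sum>F\<in>UNIV. \<gamma> A B F x * de F l k x) - (\<Sum>F\<in>UNIV. \<gamma> A B F x * de F k l x)
     = (\<Sum>C\<in>UNIV. \<Sum>D\<in>UNIV. (\<Sum>F\<in>UNIV. \<gamma> A B F x * (\<gamma> F C D x - \<gamma> F D C x)) * e C k x * e D l x)"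
  proof -
    have "(\<Sum>F\<in>UNIV. \<gamma> A B F x * de F l k x) - (\<Sum>F\<in>UNIV. \<gamma> A B F x * de F k l x)
      = (\<Sum>F\<in>UNIV. \<gamma> A B F x * (\<Sum>C\<in>UNIV. \<Sum>D\<in>UNIV. (\<gamma> F C D x - \<gamma> F D C x) * e C k x * e D l x))"
      by (simp add: torsion[OF x, symmetric] sum_subtractf right_diff_distrib)
    also have "\<dots> = (\<Sum>C\<in>UNIV. \<Sum>F\<in>UNIV. \<Sum>D\<in>UNIV. \<gamma> A B F x * ((\<gamma> F C D x - \<gamma> F D C x) * e C k x * e D l x))"
      unfolding sum_distrib_left by (rule sum.swap)
    also have "\<dots> = (\<Sum>C\<in>UNIV. \<Sum>D\<in>UNIV. \<Sum>F\<in>UNIV. \<gamma> A B F x * ((\<gamma> F C D x - \<gamma> F D C x) * e C k x * e D l x))"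
      by (rule sum.cong[OF refl], rule sum.swap)
    finally show ?thesis
      by (simp add: sum_distrib_right mult.assoc)
  qed
  have w: "(\<Sum>F\<in>UNIV. \<omega> A F k x * \<omega> F B l x)
     = (\<Sum>C\<in>UNIV. \<Sum>D\<in>UNIV. (\<Sum>F\<in>UNIV. \<gamma> A F C x * \<gamma> F B D x) * e C k x * e D l x)" for k l
  proof -
    have "(\<Sum>F\<in>UNIV. \<omega> A F k x * \<omega> F B l x)
      = (\<Sum>F\<in>UNIV. \<Sum>C\<in>UNIV. \<Sum>D\<in>UNIV. \<gamma> A F C x * e C k x * (\<gamma> F B D x * e D l x))"
      unfolding \<omega>_def sum_product ..
    also have "\<dots> = (\<Sum>C\<in>UNIV. \<Sum>F\<in>UNIV. \<Sum>D\<in>UNIV. \<gamma> A F C x * e C k x * (\<gamma> F B D x * e D l x))"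
      by (rule sum.swap)
    also have "\<dots> = (\<Sum>C\<in>UNIV. \<Sum>D\<in>UNIV. \<Sum>F\<in>UNIV. \<gamma> A F C x * e C k x * (\<gamma> F B D x * e D l x))"
      by (rule sum.cong[OF refl], rule sum.swap)
    finally show ?thesis
      unfolding sum_distrib_right by (simp add: mult_ac)
  qed
  have w': "(\<Sum>F\<in>UNIV. \<omega> A F l x * \<omega> F B k x)
     = (\<Sum>C\<in>UNIV. \<Sum>D\<in>UNIV. (\<Sum>F\<in>UNIV. \<gamma> A F D x * \<gamma> F B C x) * e C k x * e D l x)"
    unfolding w by (subst sum.swap) (simp add: mult_ac)
  have "partial_deriv k (\<omega> A B l) x - partial_deriv l (\<omega> A B k) x
      + (\<Sum>C\<in>UNIV. \<omega> A C k x * \<omega> C B l x - \<omega> A C l x * \<omega> C B k x)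
    = (\<Sum>C\<in>UNIV. \<Sum>D\<in>UNIV. d\<gamma> A B D C x * e C k x * e D l x)
      - (\<Sum>C\<in>UNIV. \<Sum>D\<in>UNIV. d\<gamma> A B C D x * e C k x * e D l x)
      + ((\<Sum>F\<in>UNIV. \<gamma> A B F x * de F l k x) - (\<Sum>F\<in>UNIV. \<gamma> A B F x * de F k l x))
      + ((\<Sum>F\<in>UNIV. \<omega> A F k x * \<omega> F B l x) - (\<Sum>F\<in>UNIV. \<omega> A F l x * \<omega> F B k x))"
    unfolding d' d[of l k] sum_subtractf by simp
  then show ?thesis
    unfolding t w[of k l] w' curvature_def
    by (simp add: sum_subtractf sum.distrib left_diff_distrib distrib_right)
qed

text \<open>Contracting the coordinate formula with \<open>e A\<close> turns Christoffel symbols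
  into connection forms. Everything beyond the curvature form is symmetric in \<open>k\<close> and
  \<open>l\<close> and drops out of the difference.\<close>

lemma riemann_up_frame:
  assumes x: "x \<in> U"
  shows "riemann_up g i j k l x =
    (\<Sum>A\<in>UNIV. E i A x * (\<Sum>B\<in>UNIV. \<Sum>C\<in>UNIV. \<Sum>D\<in>UNIV. curvature A B C D x * e B j x * e C k x * e D l x))"
proof -
  let ?dG = "\<lambda>i k j l. partial_deriv l (\<Gamma> i k j) x"
  let ?d\<omega> = "\<lambda>A B k l. partial_deriv l (\<omega> A B k) x"
  define X where "X A k l = (\<Sum>i\<in>UNIV. e A i x * (?dG i l j k + (\<Sum>m\<in>UNIV. \<Gamma> i k m x * \<Gamma> m l j x)))" for A k l
  have eG: "(\<Sum>i\<in>UNIV. e A i y * \<Gamma> i k j y) = De A k j y" if "y \<in> U" for A k j y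
    unfolding \<Gamma>_def by (rule frame_contract[OF that])
  \<comment> \<open>Differentiating \<open>eG\<close>, which holds on all of \<open>U\<close>,
    yields the contracted derivative of \<open>\<Gamma>\<close> without any formula for the
    derivative of the dual vectors.\<close>
  have d: "(\<Sum>i\<in>UNIV. e A i x * ?dG i l j k) = dde A j l k x
      + (\<Sum>B\<in>UNIV. ?d\<omega> A B l k * e B j x + \<omega> A B l x * de B j k x) - (\<Sum>i\<in>UNIV. de A i k x * \<Gamma> i l j x)" for A l k
  proof -
    have "has_partial k (\<lambda>y. \<Sum>i\<in>UNIV. e A i y * \<Gamma> i l j y)
       (\<Sum>i\<in>UNIV. de A i k x * \<Gamma> i l j x + e A i x * ?dG i l j k) x"
      by (intro has_partial_sum has_partial_mult e_partial \<Gamma>_partial x)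
    then have 1: "has_partial k (De A l j)
       (\<Sum>i\<in>UNIV. de A i k x * \<Gamma> i l j x + e A i x * ?dG i l j k) x"
      by (subst has_partial_cong_open[OF open_domain x eG[symmetric]])
    from has_partial_unique[OF 1 De_partial[OF x]] show ?thesis
      by (simp add: sum.distrib)
  qed
  have p: "(\<Sum>i\<in>UNIV. e A i x * (\<Sum>m\<in>UNIV. \<Gamma> i k m x * \<Gamma> m l j x))
      = (\<Sum>i\<in>UNIV. de A i k x * \<Gamma> i l j x) + (\<Sum>B\<in>UNIV. \<omega> A B k x * De B l j x)" for A k l
  proof -
    have "(\<Sum>i\<in>UNIV. e A i x * (\<Sum>m\<in>UNIV. \<Gamma> i k m x * \<Gamma> m l j x))
        = (\<Sum>m\<in>UNIV. (\<Sum>i\<in>UNIV. e A i x * \<Gamma> i k m x) * \<Gamma> m l j x)"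
      unfolding sum_distrib_left sum_distrib_right by (subst sum.swap) (simp add: mult.assoc)
    also have "\<dots> = (\<Sum>m\<in>UNIV. de A m k x * \<Gamma> m l j x)
        + (\<Sum>m\<in>UNIV. \<Sum>B\<in>UNIV. \<omega> A B k x * (e B m x * \<Gamma> m l j x))"
      unfolding eG[OF x] De_def by (simp add: distrib_right sum.distrib sum_distrib_right mult.assoc)
    also have "(\<Sum>m\<in>UNIV. \<Sum>B\<in>UNIV. \<omega> A B k x * (e B m x * \<Gamma> m l j x))
        = (\<Sum>B\<in>UNIV. \<omega> A B k x * (\<Sum>m\<in>UNIV. e B m x * \<Gamma> m l j x))"
      unfolding sum_distrib_left by (rule sum.swap)
    finally show ?thesis unfolding eG[OF x] .
  qed
  \<comment> \<open>The terms with \<open>de\<close> from \<open>d\<close> and \<open>p\<close> have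
    combined: the first line is symmetric under exchange of \<open>k\<close> and \<open>l\<close>,
    given \<open>dde_commute\<close>.\<close>
  have X: "X A k l = dde A j l k x + (\<Sum>B\<in>UNIV. \<omega> A B l x * de B j k x + \<omega> A B k x * de B j l x)
      + (\<Sum>B\<in>UNIV. e B j x * (?d\<omega> A B l k + (\<Sum>C\<in>UNIV. \<omega> A C k x * \<omega> C B l x)))" for A k l
  proof -
    have "(\<Sum>B\<in>UNIV. \<omega> A B k x * (\<Sum>C\<in>UNIV. \<omega> B C l x * e C j x))
       = (\<Sum>B\<in>UNIV. e B j x * (\<Sum>C\<in>UNIV. \<omega> A C k x * \<omega> C B l x))"
      unfolding sum_distrib_left by (subst sum.swap) (simp add: mult_ac)
    then show ?thesis
      unfolding X_def distrib_left sum.distrib d p De_def by (simp add: algebra_simps sum.distrib)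
  qed
  have riemann: "riemann_up g i j k l x = ?dG i l j k - ?dG i k j l
     + (\<Sum>m\<in>UNIV. \<Gamma> i k m x * \<Gamma> m l j x - \<Gamma> i l m x * \<Gamma> m k j x)" for i
    unfolding riemann_up_def christoffel_frame[OF x]
    using partial_deriv_cong_open[OF open_domain x christoffel_frame] by simp
  have R: "(\<Sum>i\<in>UNIV. e A i x * riemann_up g i j k l x) = X A k l - X A l k" for A
    unfolding X_def riemann by (simp add: sum_subtractf sum.distrib distrib_left right_diff_distrib)
  have "X A k l - X A l k = (\<Sum>B\<in>UNIV. e B j x * (?d\<omega> A B l k - ?d\<omega> A B k l
      + (\<Sum>C\<in>UNIV. \<omega> A C k x * \<omega> C B l x - \<omega> A C l x * \<omega> C B k x)))" for A
    unfolding X dde_commute[OF x, of A j k l]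
    by (simp add: sum_subtractf sum.distrib algebra_simps)
  also have "\<dots> A = (\<Sum>B\<in>UNIV. \<Sum>C\<in>UNIV. \<Sum>D\<in>UNIV. curvature A B C D x * e B j x * e C k x * e D l x)" for A
    unfolding curvature_form[OF x] sum_distrib_left by (simp add: mult_ac)
  finally show ?thesis
    using frame_contract'[OF x, of i "\<lambda>i. riemann_up g i j k l x"] unfolding R by simp
qed

end

subsection \<open>Tensors in a moving frame\<close>

definition change2 ::
    "('n::finite \<Rightarrow> 'n \<Rightarrow> real) \<Rightarrow> ('n \<Rightarrow> 'n \<Rightarrow> real) \<Rightarrow> ('n \<Rightarrow> 'n \<Rightarrow> real)" where
  "change2 P M i j = (\<Sum>A\<in>UNIV. \<Sum>B\<in>UNIV. P A B * M A i * M B j)"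

text \<open>Nesting two changes of index pairs reduces the statements about four indices to those
  about two.\<close>

definition change4 :: "('n::finite \<Rightarrow> 'n \<Rightarrow> 'n \<Rightarrow> 'n \<Rightarrow> real) \<Rightarrow> ('n \<Rightarrow> 'n \<Rightarrow> real) \<Rightarrow>
    ('n \<Rightarrow> 'n \<Rightarrow> 'n \<Rightarrow> 'n \<Rightarrow> real)" where
  "change4 T M i j k l = change2 (\<lambda>A B. change2 (T A B) M k l) M i j"

lemma sum_swap4: "(\<Sum>i\<in>I. \<Sum>j\<in>J. \<Sum>k\<in>K. \<Sum>l\<in>L. f i j k l) = (\<Sum>k\<in>K. \<Sum>l\<in>L. \<Sum>i\<in>I. \<Sum>j\<in>J. f i j k l)"
proof -
  have "(\<Sum>i\<in>I. \<Sum>j\<in>J. \<Sum>k\<in>K. \<Sum>l\<in>L. f i j k l) = (\<Sum>i\<in>I. \<Sum>k\<in>K. \<Sum>j\<in>J. \<Sum>l\<in>L. f i j k l)"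
    by (rule sum.cong[OF refl], rule sum.swap)
  also have "\<dots> = (\<Sum>k\<in>K. \<Sum>i\<in>I. \<Sum>l\<in>L. \<Sum>j\<in>J. f i j k l)"
    by (subst sum.swap, rule sum.cong[OF refl], rule sum.cong[OF refl], rule sum.swap)
  also have "\<dots> = (\<Sum>k\<in>K. \<Sum>l\<in>L. \<Sum>i\<in>I. \<Sum>j\<in>J. f i j k l)"
    by (rule sum.cong[OF refl], rule sum.swap)
  finally show ?thesis .
qed

lemma change2_sum: "(\<Sum>s\<in>S. change2 (P s) M i j) = change2 (\<lambda>A B. \<Sum>s\<in>S. P s A B) M i j"
proof -
  have "(\<Sum>s\<in>S. change2 (P s) M i j) = (\<Sum>A\<in>UNIV. \<Sum>s\<in>S. \<Sum>B\<in>UNIV. P s A B * M A i * M B j)"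
    unfolding change2_def by (rule sum.swap)
  also have "\<dots> = (\<Sum>A\<in>UNIV. \<Sum>B\<in>UNIV. \<Sum>s\<in>S. P s A B * M A i * M B j)"
    by (rule sum.cong[OF refl], rule sum.swap)
  finally show ?thesis
    by (simp add: change2_def sum_distrib_right)
qed

lemma change2_mult: "change2 P M i j * c = change2 (\<lambda>A B. P A B * c) M i j"
  unfolding change2_def sum_distrib_right by (simp add: mult_ac)

lemma change2_mult_left: "c * change2 P M i j = change2 (\<lambda>A B. c * P A B) M i j"
  unfolding change2_def sum_distrib_left by (simp add: mult_ac)

lemma change2_add: "change2 P M i j + change2 P' M i j = change2 (\<lambda>A B. P A B + P' A B) M i j"
  unfolding change2_def by (simp add: sum.distrib distrib_right)

lemma change2_diff: "change2 P M i j - change2 P' M i j = change2 (\<lambda>A B. P A B - P' A B) M i j"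
  unfolding change2_def by (simp add: sum_subtractf left_diff_distrib)

lemma change2_delta:
  "change2 (\<lambda>C D. if A = C \<and> B = D then 1 else 0) M k l = M A k * M B l"
  "change2 (\<lambda>C D. if A = D \<and> B = C then 1 else 0) M k l = M B k * M A l"
proof -
  have conj: "(if P \<and> Q then 1 else 0) = (if P then 1 else 0) * (if Q then 1 else (0::real))" for P Q
    by simp
  show "change2 (\<lambda>C D. if A = C \<and> B = D then 1 else 0) M k l = M A k * M B l"
    unfolding change2_def
    by (simp add: conj if_distrib[of "\<lambda>z. _ * z"] if_distrib[of "\<lambda>z. z * _"] cong: if_cong)
  show "change2 (\<lambda>C D. if A = D \<and> B = C then 1 else 0) M k l = M B k * M A l"
    unfolding change2_def
    by (subst sum.swap)
      (simp add: conj if_distrib[of "\<lambda>z. _ * z"] if_distrib[of "\<lambda>z. z * _"] cong: if_cong)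
qed

text \<open>Transformations of two different index pairs act independently; this is what composition
  in four indices needs.\<close>

lemma change2_commute:
  "change2 (\<lambda>s u. change2 (\<lambda>A B. G A B s u) M p q) N k l = change2 (\<lambda>A B. change2 (G A B) N k l) M p q"
  unfolding change2_def[of "\<lambda>s u. change2 (\<lambda>A B. G A B s u) M p q"] change2_mult change2_sum
  by (simp add: change2_def[of _ N])

lemma change2_compose:
  "change2 (change2 P M) N i j = change2 P (\<lambda>A q. \<Sum>p\<in>UNIV. M A p * N p q) i j"
proof -
  have "change2 (change2 P M) N i j =
      (\<Sum>p\<in>UNIV. \<Sum>q\<in>UNIV. \<Sum>A\<in>UNIV. \<Sum>B\<in>UNIV. P A B * ((M A p * N p i) * (M B q * N q j)))"
    unfolding change2_def sum_distrib_right by (simp add: mult_ac)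
  also have "\<dots> = (\<Sum>A\<in>UNIV. \<Sum>B\<in>UNIV. \<Sum>p\<in>UNIV. \<Sum>q\<in>UNIV. P A B * ((M A p * N p i) * (M B q * N q j)))"
    by (rule sum_swap4)
  also have "\<dots> = change2 P (\<lambda>A q. \<Sum>p\<in>UNIV. M A p * N p q) i j"
    unfolding change2_def mult.assoc[of "P _ _"] sum_product by (simp only: sum_distrib_left)
  finally show ?thesis .
qed

text \<open>In a full contraction the change of basis moves, transposed, to the other
  factor.\<close>

lemma change2_adjoint:
  "(\<Sum>s\<in>UNIV. \<Sum>u\<in>UNIV. change2 P M s u * X s u) = (\<Sum>A\<in>UNIV. \<Sum>B\<in>UNIV. P A B * change2 X (\<lambda>s A. M A s) A B)"
proof -
  have "(\<Sum>s\<in>UNIV. \<Sum>u\<in>UNIV. change2 P M s u * X s u)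
    = (\<Sum>s\<in>UNIV. \<Sum>u\<in>UNIV. \<Sum>A\<in>UNIV. \<Sum>B\<in>UNIV. P A B * (X s u * M A s * M B u))"
    unfolding change2_def sum_distrib_right by (simp add: mult_ac)
  also have "\<dots> = (\<Sum>A\<in>UNIV. \<Sum>B\<in>UNIV. \<Sum>s\<in>UNIV. \<Sum>u\<in>UNIV. P A B * (X s u * M A s * M B u))"
    by (rule sum_swap4)
  finally show ?thesis
    unfolding change2_def sum_distrib_left .
qed

lemma change2_diagonal:
  "change2 P (\<lambda>A B. if A = B then c A else 0) i j = P i j * c i * c j"
  unfolding change2_def
  by (simp add: if_distrib[of "\<lambda>z. _ * z"] if_distrib[of "\<lambda>z. z * _"] cong: if_cong)

text \<open>The hypothesis says that \<open>N\<close> is \<open>M\<close> with its coordinate index raised, \<open>c\<close> being the diagonal inverse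
  metric in the frame.\<close>

lemma change2_contract:
  assumes "\<And>A B. (\<Sum>s\<in>UNIV. N B s * M A s) = (if B = A then c B else 0)"
  shows "(\<Sum>s\<in>UNIV. \<Sum>u\<in>UNIV. change2 P M s u * change2 R N s u)
    = (\<Sum>A\<in>UNIV. \<Sum>B\<in>UNIV. P A B * (R A B * c A * c B))"
  unfolding change2_adjoint change2_compose assms change2_diagonal ..

lemma change4_contract:
  assumes "\<And>A B. (\<Sum>s\<in>UNIV. N B s * M A s) = (if B = A then c B else 0)"
  shows "(\<Sum>i\<in>UNIV. \<Sum>j\<in>UNIV. \<Sum>k\<in>UNIV. \<Sum>l\<in>UNIV. change4 P M i j k l * change4 R N i j k l)
    = (\<Sum>A\<in>UNIV. \<Sum>B\<in>UNIV. \<Sum>C\<in>UNIV. \<Sum>D\<in>UNIV.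
        P A B C D * R A B C D * (c A * c B * c C * c D))"
proof -
  have "(\<Sum>i\<in>UNIV. \<Sum>j\<in>UNIV. \<Sum>k\<in>UNIV. \<Sum>l\<in>UNIV. change4 P M i j k l * change4 R N i j k l)
     = (\<Sum>k\<in>UNIV. \<Sum>l\<in>UNIV. \<Sum>i\<in>UNIV. \<Sum>j\<in>UNIV. change4 P M i j k l * change4 R N i j k l)"
    by (rule sum_swap4)
  also have "\<dots> = (\<Sum>k\<in>UNIV. \<Sum>l\<in>UNIV. \<Sum>A\<in>UNIV. \<Sum>B\<in>UNIV. change2 (P A B) M k l * (change2 (R A B) N k l * c A * c B))"
    unfolding change4_def change2_contract[OF assms] ..
  also have "\<dots> = (\<Sum>A\<in>UNIV. \<Sum>B\<in>UNIV. \<Sum>k\<in>UNIV. \<Sum>l\<in>UNIV. change2 (P A B) M k l * (change2 (R A B) N k l * c A * c B))"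
    by (rule sum_swap4)
  also have "\<dots> = (\<Sum>A\<in>UNIV. \<Sum>B\<in>UNIV. (\<Sum>k\<in>UNIV. \<Sum>l\<in>UNIV. change2 (P A B) M k l * change2 (R A B) N k l) * (c A * c B))"
    unfolding sum_distrib_right by (simp add: mult_ac)
  also have "\<dots> = (\<Sum>A\<in>UNIV. \<Sum>B\<in>UNIV. \<Sum>C\<in>UNIV. \<Sum>D\<in>UNIV.
        P A B C D * R A B C D * (c A * c B * c C * c D))"
    unfolding change2_contract[OF assms] sum_distrib_right by (simp add: mult_ac)
  finally show ?thesis .
qed

lemma change4_compose:
  "change4 (change4 T M) N i j k l = change4 T (\<lambda>A q. \<Sum>p\<in>UNIV. M A p * N p q) i j k l"
proof -
  have "change2 (\<lambda>C D. change2 (\<lambda>A B. change2 (T A B) M C D) M p q) N k l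
      = change2 (\<lambda>A B. change2 (T A B) (\<lambda>A q. \<Sum>p\<in>UNIV. M A p * N p q) k l) M p q" for p q
    by (subst change2_commute) (simp only: change2_compose)
  then show ?thesis
    unfolding change4_def by (simp only: change2_compose)
qed

lemma change4_eq: "change4 T M i j k l =
  (\<Sum>A\<in>UNIV. \<Sum>B\<in>UNIV. \<Sum>C\<in>UNIV. \<Sum>D\<in>UNIV. T A B C D * M A i * M B j * M C k * M D l)"
  unfolding change4_def change2_def sum_distrib_right by (simp add: mult_ac)

text \<open>Tailored to the dual Weyl tensor: one index pair is contracted with its raised partner,
  while the outer pairs stay in the frame.\<close>

lemma change4_dual:
  assumes "\<And>A B. (\<Sum>s\<in>UNIV. N B s * M A s) = (if B = A then c B else 0)"
  shows "(\<Sum>s\<in>UNIV. \<Sum>u\<in>UNIV. change4 P M i j s u * change2 (\<lambda>A B. change2 (R A B) M k l) N s u)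
    = change4 (\<lambda>A B C D. \<Sum>E\<in>UNIV. \<Sum>F\<in>UNIV. P A B E F * R E F C D * (c E * c F)) M i j k l"
proof -
  have "(\<Sum>s\<in>UNIV. \<Sum>u\<in>UNIV. change4 P M i j s u * change2 (\<lambda>A B. change2 (R A B) M k l) N s u)
     = change2 (\<lambda>A B. \<Sum>s\<in>UNIV. \<Sum>u\<in>UNIV. change2 (P A B) M s u * change2 (\<lambda>A B. change2 (R A B) M k l) N s u) M i j"
    unfolding change4_def by (simp only: change2_mult[of _ M i j] change2_sum[of _ M i j])
  also have "\<dots> = change2 (\<lambda>A B. \<Sum>E\<in>UNIV. \<Sum>F\<in>UNIV. P A B E F * (change2 (R E F) M k l * c E * c F)) M i j"
    unfolding change2_contract[OF assms] ..
  also have "\<dots> = change2 (\<lambda>A B. change2 (\<lambda>C D. \<Sum>E\<in>UNIV. \<Sum>F\<in>UNIV. P A B E F * (R E F C D * c E * c F)) M k l) M i j"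
    by (simp only: change2_mult[of _ M k l] change2_mult_left[of _ _ M k l] change2_sum[of _ M k l])
  finally show ?thesis
    unfolding change4_def by (simp add: mult.assoc)
qed

section \<open>Weyl tensor when the curvature is a constant-curvature part plus a trace-free
  part\<close>

context moving_frame
begin

definition frame :: "real^'n \<Rightarrow> 'n \<Rightarrow> 'n \<Rightarrow> real" where
  "frame x A i = e A i x"

text \<open>Division by \<open>h A\<close> makes this the metric dual of \<open>e A\<close> rather
  than its algebraic dual. A tensor with raised indices then has the same components with respect to
  \<open>coframe\<close> as the original has with respect to \<open>frame\<close>.\<close>

definition coframe :: "real^'n \<Rightarrow> 'n \<Rightarrow> 'n \<Rightarrow> real" where
  "coframe x A i = E i A x / h A x"

lemma frame_coframe:
  assumes "x \<in> U"
  shows "(\<Sum>s\<in>UNIV. coframe x B s * frame x A s) = (if B = A then 1 / h B x else 0)"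
proof -
  have "(\<Sum>s\<in>UNIV. coframe x B s * frame x A s) = (\<Sum>s\<in>UNIV. e A s x * E s B x) / h B x"
    unfolding frame_def coframe_def sum_divide_distrib by (simp add: mult_ac)
  then show ?thesis
    unfolding dual'[OF assms] by auto
qed

lemma frame_raise:
  assumes "x \<in> U"
  shows "(\<Sum>p\<in>UNIV. frame x A p * matrix_inv (g x) $ i $ p) = coframe x A i"
proof -
  have "(\<Sum>p\<in>UNIV. frame x A p * matrix_inv (g x) $ i $ p)
      = (\<Sum>p\<in>UNIV. e A p x * (\<Sum>B\<in>UNIV. E p B x * (E i B x / h B x)))"
    by (simp add: frame_def matrix_inv_metric[OF assms] mult_ac)
  then show ?thesis
    unfolding frame_contract[OF assms] coframe_def .
qed

lemma metric_change2:
  assumes "x \<in> U"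
  shows "g x $ i $ j = change2 (\<lambda>A B. if A = B then h A x else 0) (frame x) i j"
  unfolding metric[OF assms] change2_def frame_def
  by (simp add: if_distrib[of "\<lambda>z. z * _"] cong: if_cong)

lemma riemann_frame:
  assumes x: "x \<in> U"
  shows "riemann g i j k l x = change4 (\<lambda>A B C D. h A x * curvature A B C D x) (frame x) i j k l"
proof -
  have "riemann g i j k l x = (\<Sum>A\<in>UNIV. h A x * e A i x *
      (\<Sum>B\<in>UNIV. \<Sum>C\<in>UNIV. \<Sum>D\<in>UNIV. curvature A B C D x * e B j x * e C k x * e D l x))"
    unfolding riemann_def metric_contract[OF x] riemann_up_frame[OF x] frame_contract[OF x] ..
  then show ?thesis
    unfolding change4_eq frame_def sum_distrib_left by (simp add: mult_ac)
qed

lemma ricci_frame: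
  assumes x: "x \<in> U"
  shows "ricci g j l x = change2 (\<lambda>B D. \<Sum>A\<in>UNIV. curvature A B A D x) (frame x) j l"
proof -
  let ?f = "\<lambda>A C. \<Sum>B\<in>UNIV. \<Sum>D\<in>UNIV. curvature A B C D x * e B j x * e D l x"
  have "ricci g j l x = (\<Sum>i\<in>UNIV. \<Sum>A\<in>UNIV. E i A x * (\<Sum>C\<in>UNIV. e C i x * ?f A C))"
  proof -
    have "(\<Sum>B\<in>UNIV. \<Sum>C\<in>UNIV. \<Sum>D\<in>UNIV. curvature A B C D x * e B j x * e C i x * e D l x)
        = (\<Sum>C\<in>UNIV. e C i x * ?f A C)" for A i
      unfolding sum_distrib_left by (subst sum.swap) (simp add: mult_ac)
    then show ?thesis
      unfolding ricci_def riemann_up_frame[OF x] by simp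
  qed
  also have "\<dots> = (\<Sum>A\<in>UNIV. \<Sum>i\<in>UNIV. \<Sum>C\<in>UNIV. e C i x * E i A x * ?f A C)"
    unfolding sum_distrib_left[of "E _ _ x"] by (subst sum.swap) (simp add: mult_ac)
  also have "\<dots> = (\<Sum>A\<in>UNIV. \<Sum>C\<in>UNIV. (\<Sum>i\<in>UNIV. e C i x * E i A x) * ?f A C)"
    unfolding sum_distrib_right[of "\<lambda>i. e _ i x * E i _ x"] by (rule sum.cong[OF refl], rule sum.swap)
  also have "\<dots> = (\<Sum>A\<in>UNIV. ?f A A)"
    unfolding dual'[OF x] by (simp add: if_distrib[of "\<lambda>z. z * _"] cong: if_cong)
  also have "\<dots> = (\<Sum>A\<in>UNIV. change2 (\<lambda>B D. curvature A B A D x) (frame x) j l)"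
    unfolding change2_def frame_def ..
  finally show ?thesis
    unfolding change2_sum .
qed

context
  fixes x :: "real^'n" and W :: "'n \<Rightarrow> 'n \<Rightarrow> 'n \<Rightarrow> 'n \<Rightarrow> real" and \<kappa> :: real
  assumes x: "x \<in> U"
    and curvature_decomp: "\<And>A B C D. h A x * curvature A B C D x = W A B C D
      + \<kappa> * h A x * h B x * ((if A = C \<and> B = D then 1 else 0) - (if A = D \<and> B = C then 1 else 0))"
    and traceless: "\<And>B D. (\<Sum>A\<in>UNIV. W A B A D / h A x) = 0"
begin

text \<open>The trace-free part contributes nothing, and the constant-curvature part has n - 1
  nonzero terms in each diagonal trace.\<close>

lemma ricci_einstein: "ricci g j l x = \<kappa> * (real CARD('n) - 1) * g x $ j $ l"
proof -
  have "(\<Sum>A\<in>UNIV. curvature A B A D x) = \<kappa> * (real CARD('n) - 1) * (if B = D then h B x else 0)" for B D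
  proof -
    have curv: "curvature A B A D x = W A B A D / h A x
        + \<kappa> * h B x * ((if B = D then 1 else 0) - (if A = B then (if B = D then 1 else 0) else 0))" for A
    proof -
      have "curvature A B A D x = (h A x * curvature A B A D x) / h A x"
        using h_nonzero[OF x, of A] by simp
      then show ?thesis
        unfolding curvature_decomp using h_nonzero[OF x, of A] by (auto simp: add_divide_distrib)
    qed
    have "(\<Sum>A\<in>UNIV. curvature A B A D x) = (\<Sum>A\<in>UNIV. W A B A D / h A x)
        + \<kappa> * h B x * ((\<Sum>A\<in>(UNIV::'n set). if B = D then 1 else 0)
          - (\<Sum>A\<in>UNIV. if A = B then (if B = D then 1 else 0) else 0))"
      unfolding curv sum.distrib sum_distrib_left[symmetric] sum_subtractf ..
    then show ?thesis
      unfolding traceless by simp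
  qed
  then show ?thesis
    unfolding ricci_frame[OF x] metric_change2[OF x] change2_mult_left by simp
qed

lemma scalar_curvature_einstein:
  "scalar_curvature g x = \<kappa> * (real CARD('n) - 1) * real CARD('n)"
proof -
  have "matrix_inv (g x) ** g x = mat 1"
    using metric_inverse[OF x] matrix_inv_eqI[OF metric_inverse[OF x]] matrix_left_right_inverse by metis
  moreover have "(\<Sum>l\<in>UNIV. matrix_inv (g x) $ j $ l * g x $ j $ l) = (matrix_inv (g x) ** g x) $ j $ j" for j
    by (simp add: matrix_matrix_mult_def metric[OF x] mult_ac)
  ultimately have "(\<Sum>l\<in>UNIV. matrix_inv (g x) $ j $ l * g x $ j $ l) = 1" for j
    by (simp add: mat_def)
  then have "(\<Sum>l\<in>UNIV. matrix_inv (g x) $ j $ l * ricci g j l x) = \<kappa> * (real CARD('n) - 1)" for j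
    unfolding ricci_einstein mult.left_commute[of "matrix_inv _ $ _ $ _"] sum_distrib_left[symmetric] by simp
  then show ?thesis
    unfolding scalar_curvature_def by simp
qed

text \<open>For an Einstein metric the Ricci terms subtract 2 \<kappa> (n - 1)/(n - 2) and the
  scalar term restores \<kappa> n/(n - 2) times the same tensor. The net effect is to remove exactly
  the constant-curvature part.\<close>

lemma weyl_einstein:
  assumes "CARD('n) \<ge> 3"
  shows "weyl g i j k l x = change4 W (frame x) i j k l"
proof -
  have gg: "change4 (\<lambda>A B C D. h A x * h B x * ((if A = C \<and> B = D then 1 else 0) - (if A = D \<and> B = C then 1 else 0)))
       (frame x) i j k l = g x $ i $ k * g x $ j $ l - g x $ i $ l * g x $ j $ k"
  proof -
    have "change2 (\<lambda>C D. h A x * h B x * ((if A = C \<and> B = D then 1 else 0) - (if A = D \<and> B = C then 1 else 0))) (frame x) k l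
      = h A x * h B x * (e A k x * e B l x - e B k x * e A l x)" for A B
      by (simp only: change2_mult_left[symmetric] change2_diff[symmetric] change2_delta frame_def)
    then have "change4 (\<lambda>A B C D. h A x * h B x * ((if A = C \<and> B = D then 1 else 0) - (if A = D \<and> B = C then 1 else 0)))
       (frame x) i j k l = change2 (\<lambda>A B. h A x * h B x * (e A k x * e B l x - e B k x * e A l x)) (frame x) i j"
      unfolding change4_def by simp
    then show ?thesis
      unfolding change2_def frame_def metric[OF x] sum_product
      by (simp add: left_diff_distrib right_diff_distrib sum_subtractf mult_ac)
  qed
  have "riemann g i j k l x = change4 W (frame x) i j k l + \<kappa> *
     change4 (\<lambda>A B C D. h A x * h B x * ((if A = C \<and> B = D then 1 else 0) - (if A = D \<and> B = C then 1 else 0))) (frame x) i j k l"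
    unfolding riemann_frame[OF x] curvature_decomp change4_def change2_add change2_mult_left by (simp add: mult_ac)
  then have "riemann g i j k l x = change4 W (frame x) i j k l + \<kappa> * (g x $ i $ k * g x $ j $ l - g x $ i $ l * g x $ j $ k)"
    unfolding gg .
  moreover have "real CARD('n) - 1 \<noteq> 0" "real CARD('n) - 2 \<noteq> 0"
    using assms by auto
  ultimately show ?thesis
    unfolding weyl_def ricci_einstein scalar_curvature_einstein
    by (simp add: divide_simps) (simp add: algebra_simps)
qed

lemma weyl_up_einstein:
  assumes "CARD('n) \<ge> 3"
  shows "weyl_up g i j k l x = change4 W (coframe x) i j k l"
proof -
  have "weyl_up g i j k l x = change4 (change4 W (frame x)) (\<lambda>p i. matrix_inv (g x) $ i $ p) i j k l"
    unfolding weyl_up_def change4_eq[of "change4 W (frame x)"] weyl_einstein[OF assms]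
    by (simp add: mult_ac)
  then show ?thesis
    unfolding change4_compose frame_raise[OF x] .
qed

end

end

subsection \<open>The permutation symbol in dimension four\<close>

lemma det_4:
  fixes A :: "'a::comm_ring_1^4^4"
  shows "det A =
    A$1$1 * (A$2$2 * A$3$3 * A$4$4 + A$2$3 * A$3$4 * A$4$2 + A$2$4 * A$3$2 * A$4$3
      - A$2$2 * A$3$4 * A$4$3 - A$2$3 * A$3$2 * A$4$4 - A$2$4 * A$3$3 * A$4$2)
    - A$1$2 * (A$2$1 * A$3$3 * A$4$4 + A$2$3 * A$3$4 * A$4$1 + A$2$4 * A$3$1 * A$4$3
      - A$2$1 * A$3$4 * A$4$3 - A$2$3 * A$3$1 * A$4$4 - A$2$4 * A$3$3 * A$4$1)
    + A$1$3 * (A$2$1 * A$3$2 * A$4$4 + A$2$2 * A$3$4 * A$4$1 + A$2$4 * A$3$1 * A$4$2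
      - A$2$1 * A$3$4 * A$4$2 - A$2$2 * A$3$1 * A$4$4 - A$2$4 * A$3$2 * A$4$1)
    - A$1$4 * (A$2$1 * A$3$2 * A$4$3 + A$2$2 * A$3$3 * A$4$1 + A$2$3 * A$3$1 * A$4$2
      - A$2$1 * A$3$3 * A$4$2 - A$2$2 * A$3$1 * A$4$3 - A$2$3 * A$3$2 * A$4$1)"
proof -
  have f1: "finite {2::4, 3, 4}" "1 \<notin> {2::4, 3, 4}"
    and f2: "finite {3::4, 4}" "2 \<notin> {3::4, 4}"
    and f3: "finite {4::4}" "3 \<notin> {4::4}"
    by auto
  show ?thesis
    unfolding det_def UNIV_4
    unfolding sum_over_permutations_insert[OF f1]
    unfolding sum_over_permutations_insert[OF f2]
    unfolding sum_over_permutations_insert[OF f3]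
    unfolding permutes_sing
    by (simp add: sign_swap_id permutation_swap_id permutation_compose sign_compose sign_id swap_id_eq
        algebra_simps)
qed

text \<open>The matrix selects columns of the identity according to \<open>p\<close>; a repeated
  column gives zero. Multiplicativity and multilinearity of the determinant become available for the
  symbol.\<close>

lemma levi_civita_symbol_det:
  "levi_civita_symbol p = det (\<chi> i j. if i = p j then 1 else 0 :: real^'n^'n::finite)"
proof (cases "p permutes UNIV")
  case True
  have "det (\<chi> i j. (mat 1 :: real^'n^'n) $ i $ p j) = of_int (sign p) * det (mat 1 :: real^'n^'n)"
    by (rule det_permute_columns[OF True])
  moreover have "(\<chi> i j. (mat 1 :: real^'n^'n) $ i $ p j) = (\<chi> i j. if i = p j then 1 else 0)"
    by (simp add: mat_def)
  ultimately show ?thesis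
    using True by (simp add: levi_civita_symbol_def)
next
  case False
  then have "\<not> inj p"
    by (simp add: permutes_def bij_def[symmetric] bij_iff finite_UNIV_inj_surj) (metis bij_def bij_iff finite_UNIV_inj_surj finite_class.finite_UNIV)
  then obtain j k where "j \<noteq> k" "p j = p k"
    by (auto simp: inj_def)
  then have "det (\<chi> i j. if i = p j then 1 else 0 :: real^'n^'n) = 0"
    by (intro det_identical_columns[of j k]) (auto simp: column_def)
  then show ?thesis
    using False by (simp add: levi_civita_symbol_def)
qed

definition det_columns :: "real^4 \<Rightarrow> real^4 \<Rightarrow> real^4 \<Rightarrow> real^4 \<Rightarrow> real" where
  "det_columns a b c d = det (\<chi> i j. (vector [a, b, c, d] :: real^4^4) $ j $ i)"

lemma vector_4_index:
  fixes a b c d :: "'a::zero"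
  shows "(vector [a, b, c, d] :: 'a^4) $ 1 = a" "(vector [a, b, c, d] :: 'a^4) $ 2 = b"
    "(vector [a, b, c, d] :: 'a^4) $ 3 = c" "(vector [a, b, c, d] :: 'a^4) $ 4 = d"
  unfolding vector_def by simp_all

definition eps :: "4 \<Rightarrow> 4 \<Rightarrow> 4 \<Rightarrow> 4 \<Rightarrow> real" where
  "eps i j k l = levi_civita_symbol (($) (vector [i, j, k, l] :: 4^4))"

lemma eps_det_columns: "eps i j k l = det_columns (axis i 1) (axis j 1) (axis k 1) (axis l 1)"
proof -
  have "(if b = (vector [i, j, k, l] :: 4^4) $ c then 1 else 0)
      = (vector [axis i 1, axis j 1, axis k 1, axis l 1] :: real^4^4) $ c $ b" for b c :: 4
    using exhaust_4[of c] by (auto simp: vector_4_index axis_def)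
  then show ?thesis
    unfolding eps_def levi_civita_symbol_det det_columns_def by simp
qed

lemma det_columns_eq: "det_columns a b c d =
    a$1 * (b$2 * (c$3 * d$4 - d$3 * c$4) - c$2 * (b$3 * d$4 - d$3 * b$4) + d$2 * (b$3 * c$4 - c$3 * b$4))
    - b$1 * (a$2 * (c$3 * d$4 - d$3 * c$4) - c$2 * (a$3 * d$4 - d$3 * a$4) + d$2 * (a$3 * c$4 - c$3 * a$4))
    + c$1 * (a$2 * (b$3 * d$4 - d$3 * b$4) - b$2 * (a$3 * d$4 - d$3 * a$4) + d$2 * (a$3 * b$4 - b$3 * a$4))
    - d$1 * (a$2 * (b$3 * c$4 - c$3 * b$4) - b$2 * (a$3 * c$4 - c$3 * a$4) + c$2 * (a$3 * b$4 - b$3 * a$4))"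
  unfolding det_columns_def det_4 by (simp add: vector_4_index algebra_simps)

lemma det_columns_sum:
  "(\<Sum>C\<in>UNIV. \<Sum>D\<in>UNIV. det_columns a b (axis C 1) (axis D 1) * M C * N D)
     = det_columns a b (\<chi> C. M C) (\<chi> D. N D)"
  "(\<Sum>A\<in>UNIV. \<Sum>B\<in>UNIV. det_columns (axis A 1) (axis B 1) c d * M A * N B)
     = det_columns (\<chi> A. M A) (\<chi> B. N B) c d"
  unfolding det_columns_eq sum_4
  by (simp_all add: axis_def algebra_simps)

text \<open>Selecting columns \<open>i\<close>, \<open>j\<close>, \<open>k\<close>, \<open>l\<close>
  of \<open>M\<close> is multiplication by a selection matrix, whose determinant is
  \<open>eps i j k l\<close>. The left side is the multilinear expansion of the determinant of the
  selected columns.\<close>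

lemma eps_sum:
  fixes M :: "4 \<Rightarrow> 4 \<Rightarrow> real"
  shows "(\<Sum>A\<in>UNIV. \<Sum>B\<in>UNIV. (\<Sum>C\<in>UNIV. \<Sum>D\<in>UNIV. eps A B C D * M C k * M D l) * M A i * M B j)
     = det (\<chi> A i. M A i) * eps i j k l"
proof -
  let ?M = "\<chi> A i. M A i" and ?v = "vector [i, j, k, l] :: 4^4"
  have "det ?M * eps i j k l = det (?M ** (\<chi> A c. if A = ?v $ c then 1 else 0))"
    unfolding eps_def levi_civita_symbol_det det_mul ..
  also have "?M ** (\<chi> A c. if A = ?v $ c then 1 else 0) = (\<chi> A c. M A (?v $ c))"
    by (simp add: matrix_matrix_mult_def if_distrib[of "\<lambda>z. _ * z"] cong: if_cong)
  also have "\<dots> = (\<chi> A c. (vector [\<chi> A. M A i, \<chi> A. M A j, \<chi> A. M A k, \<chi> A. M A l] :: real^4^4) $ c $ A)"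
  proof -
    have "M A (?v $ c) = (vector [\<chi> A. M A i, \<chi> A. M A j, \<chi> A. M A k, \<chi> A. M A l] :: real^4^4) $ c $ A" for A c
      using exhaust_4[of c] by (auto simp: vector_4_index)
    then show ?thesis by simp
  qed
  finally have "det ?M * eps i j k l = det_columns (\<chi> A. M A i) (\<chi> A. M A j) (\<chi> A. M A k) (\<chi> A. M A l)"
    unfolding det_columns_def .
  then show ?thesis
    unfolding eps_det_columns det_columns_sum by simp
qed

lemma index_4_neq: "((1::4) = 2) = False" "((1::4) = 3) = False" "((1::4) = 4) = False"
 "((2::4) = 1) = False" "((2::4) = 3) = False" "((2::4) = 4) = False"
 "((3::4) = 1) = False" "((3::4) = 2) = False" "((3::4) = 4) = False"
 "((4::4) = 1) = False" "((4::4) = 2) = False" "((4::4) = 3) = False"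
  by simp_all

lemma prod_4: "prod f (UNIV :: 4 set) = f 1 * f 2 * f 3 * f 4"
  unfolding UNIV_4 by (simp add: ac_simps)

lemma axis_nth_4: "axis (1::4) (1::real) $ 1 = 1" "axis (1::4) (1::real) $ 2 = 0" "axis (1::4) (1::real) $ 3 = 0" "axis (1::4) (1::real) $ 4 = 0"
  "axis (2::4) (1::real) $ 1 = 0" "axis (2::4) (1::real) $ 2 = 1" "axis (2::4) (1::real) $ 3 = 0" "axis (2::4) (1::real) $ 4 = 0"
  "axis (3::4) (1::real) $ 1 = 0" "axis (3::4) (1::real) $ 2 = 0" "axis (3::4) (1::real) $ 3 = 1" "axis (3::4) (1::real) $ 4 = 0"
  "axis (4::4) (1::real) $ 1 = 0" "axis (4::4) (1::real) $ 2 = 0" "axis (4::4) (1::real) $ 3 = 0" "axis (4::4) (1::real) $ 4 = 1"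
  by (simp_all add: axis_def)

text \<open>The dual of a bivector as a table, so that the fourfold sum for I_2 never expands the
  permutation symbol. Since \<open>X\<close> need not be antisymmetric, the entries are
  differences.\<close>

lemma eps_values:
  fixes X :: "4 \<Rightarrow> 4 \<Rightarrow> real"
  shows "(\<Sum>E\<in>UNIV. \<Sum>F\<in>UNIV. eps A B E F * X E F) =
    (vector [vector [0, X 3 4 - X 4 3, X 4 2 - X 2 4, X 2 3 - X 3 2],
             vector [X 4 3 - X 3 4, 0, X 1 4 - X 4 1, X 3 1 - X 1 3],
             vector [X 2 4 - X 4 2, X 4 1 - X 1 4, 0, X 1 2 - X 2 1],
             vector [X 3 2 - X 2 3, X 1 3 - X 3 1, X 2 1 - X 1 2, 0]] :: real^4^4) $ A $ B" (is "?L A B = ?R A B")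
proof -
  have "\<forall>A B. ?L A B = ?R A B"
    unfolding forall_4 sum_4 eps_det_columns det_columns_eq
    by (simp only: vector_4_index axis_nth_4 mult_zero_left mult_zero_right diff_self diff_0_right diff_0
        add_0_left add_0_right mult_1_left mult_1_right minus_zero mult_minus_left mult_minus_right
        diff_conv_add_uminus minus_minus) (simp add: algebra_simps)
  then show ?thesis by blast
qed

subsection \<open>The connection of the Kerr-de Sitter frame and its curvature\<close>

text \<open>The entry \<open>$ A $ B $ C\<close> is the component of the connection form with
  indices \<open>A\<close>, \<open>B\<close> along covector \<open>C\<close>. The arguments after
  \<open>a\<close> stand for the functions substituted in \<open>conn\<close>; \<open>u\<close> and
  \<open>w\<close> are half the logarithmic derivatives of Q/S in r and of Y/S in x.\<close>

definition kerr_connection ::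
    "real \<Rightarrow> real \<Rightarrow> real \<Rightarrow> real \<Rightarrow> real \<Rightarrow> real \<Rightarrow> real \<Rightarrow> real \<Rightarrow> real \<Rightarrow> real \<Rightarrow> real^4^4^4" where
  "kerr_connection a b d u w k k' n p q = vector
    [vector [vector [0, u, - a\<^sup>2 * d, 0],
             vector [u, 0, 0, a * (b * k)],
             vector [a\<^sup>2 * d, 0, 0, - a * d],
             vector [0, a * (b * k), a * d, 0]],
     vector [vector [u * p, 0, 0, a * (b * n)],
             vector [0, - u, a\<^sup>2 * d, 0],
             vector [0, a\<^sup>2 * d, - (b * k'), 0],
             vector [a * (b * n), 0, 0, - (b * n)]],
     vector [vector [a\<^sup>2 * (d * n), 0, 0, - a * (d * n)],
             vector [0, - a\<^sup>2 * (d * k), b, 0],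
             vector [0, b, - w, 0],
             vector [- a * (d * n), 0, 0, - (w * q)]],
     vector [vector [0, a * b, a * (d * k'), 0],
             vector [- a * b, 0, 0, b],
             vector [a * (d * k'), 0, 0, w],
             vector [0, - b, w, 0]]]"

text \<open>The product rule applied entrywise. The table is linear in the nine derivative
  arguments, so r- and x-derivatives can be combined by the chain rule.\<close>

definition kerr_connection_deriv where
  "kerr_connection_deriv a b d u w k k' n p q db dd du dw dk dk' dn dp dq = (vector
    [vector [vector [0, du, - a\<^sup>2 * dd, 0],
             vector [du, 0, 0, a * (db * k + b * dk)],
             vector [a\<^sup>2 * dd, 0, 0, - a * dd],
             vector [0, a * (db * k + b * dk), a * dd, 0]],
     vector [vector [du * p + u * dp, 0, 0, a * (db * n + b * dn)],
             vector [0, - du, a\<^sup>2 * dd, 0],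
             vector [0, a\<^sup>2 * dd, - (db * k' + b * dk'), 0],
             vector [a * (db * n + b * dn), 0, 0, - (db * n + b * dn)]],
     vector [vector [a\<^sup>2 * (dd * n + d * dn), 0, 0, - a * (dd * n + d * dn)],
             vector [0, - a\<^sup>2 * (dd * k + d * dk), db, 0],
             vector [0, db, - dw, 0],
             vector [- a * (dd * n + d * dn), 0, 0, - (dw * q + w * dq)]],
     vector [vector [0, a * db, a * (dd * k' + d * dk'), 0],
             vector [- a * db, 0, 0, db],
             vector [a * (dd * k' + d * dk'), 0, 0, dw],
             vector [0, - db, dw, 0]]] :: real^4^4^4)"

definition bivec :: "4 \<Rightarrow> 4 \<Rightarrow> 4 \<Rightarrow> 4 \<Rightarrow> real" where
  "bivec P Q A B = (if A = P \<and> B = Q then 1 else 0) - (if A = Q \<and> B = P then 1 else 0)"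

text \<open>The curvature tensor of constant curvature 1 for the diagonal metric
  \<open>h\<close>.\<close>

definition wedge :: "(4 \<Rightarrow> real) \<Rightarrow> 4 \<Rightarrow> 4 \<Rightarrow> 4 \<Rightarrow> 4 \<Rightarrow> real" where
  "wedge h A B C D = h A * h B * ((if A = C \<and> B = D then 1 else 0) - (if A = D \<and> B = C then 1 else 0))"

text \<open>The Weyl tensor of type D is \<open>type_D h p (3 * p) (- 3 * p) v\<close>; the bivectors \<open>bivec 1 2\<close> and
  \<open>bivec 3 4\<close> span the two distinguished planes, and the terms following \<open>v\<close> are completed so
  that the first Bianchi identity holds.\<close>

definition type_D :: "(4 \<Rightarrow> real) \<Rightarrow> real \<Rightarrow> real \<Rightarrow> real \<Rightarrow> real \<Rightarrow> 4 \<Rightarrow> 4 \<Rightarrow> 4 \<Rightarrow> 4 \<Rightarrow> real" where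
  "type_D h k p q v A B C D = k * wedge h A B C D
     + p * (bivec 1 2 A B * bivec 1 2 C D) + q * (bivec 3 4 A B * bivec 3 4 C D)
     + v * (2 * (bivec 1 2 A B * bivec 3 4 C D) + 2 * (bivec 3 4 A B * bivec 1 2 C D)
       + bivec 1 2 A C * bivec 3 4 B D - bivec 1 2 A D * bivec 3 4 B C
       + bivec 3 4 A C * bivec 1 2 B D - bivec 3 4 A D * bivec 1 2 B C)"

text \<open>Here \<open>Q\<close> is a function of \<open>r\<close> and \<open>Y\<close> one of \<open>x\<close>; \<open>Q1\<close>, \<open>Q2\<close>, \<open>Y1\<close>, \<open>Y2\<close> are one half of their first
  and second derivatives. Treating \<open>iS\<close>, \<open>iQ\<close>, \<open>iY\<close> as variables subject to \<open>S * iS = 1\<close> etc. turns all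
  identities into polynomial ones modulo these relations.\<close>

context
  fixes a r x Q Q1 Q2 Y Y1 Y2 S iS iQ iY :: real
begin

definition "conn = kerr_connection a (r * iS) (x * iS) (Q1 * iQ - r * iS) (Y1 * iY - a\<^sup>2 * x * iS)
   (Y * iQ) (Q * iY) (Q * Y * iS\<^sup>2) (Q\<^sup>2 * iS\<^sup>2) (Y\<^sup>2 * iS\<^sup>2)"

text \<open>All letters are numbers here, so the derivatives are written out by hand; that they are
  derivatives is the content of \<open>conn_partial\<close>.\<close>

definition "conn_dr = kerr_connection_deriv a (r * iS) (x * iS) (Q1 * iQ - r * iS) (Y1 * iY - a\<^sup>2 * x * iS)
   (Y * iQ) (Q * iY) (Q * Y * iS\<^sup>2) (Q\<^sup>2 * iS\<^sup>2) (Y\<^sup>2 * iS\<^sup>2)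
   (iS - 2 * r\<^sup>2 * iS\<^sup>2) (- 2 * r * x * iS\<^sup>2) (Q2 * iQ - 2 * Q1\<^sup>2 * iQ\<^sup>2 - iS + 2 * r\<^sup>2 * iS\<^sup>2) (2 * a\<^sup>2 * r * x * iS\<^sup>2)
   (- 2 * Y * Q1 * iQ\<^sup>2) (2 * Q1 * iY) (2 * Q1 * Y * iS\<^sup>2 - 4 * r * Q * Y * iS^3)
   (4 * Q * Q1 * iS\<^sup>2 - 4 * r * Q\<^sup>2 * iS^3) (- 4 * r * Y\<^sup>2 * iS^3)"

definition "conn_dx = kerr_connection_deriv a (r * iS) (x * iS) (Q1 * iQ - r * iS) (Y1 * iY - a\<^sup>2 * x * iS)
   (Y * iQ) (Q * iY) (Q * Y * iS\<^sup>2) (Q\<^sup>2 * iS\<^sup>2) (Y\<^sup>2 * iS\<^sup>2)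
   (- 2 * a\<^sup>2 * r * x * iS\<^sup>2) (iS - 2 * a\<^sup>2 * x\<^sup>2 * iS\<^sup>2) (2 * a\<^sup>2 * r * x * iS\<^sup>2)
   (Y2 * iY - 2 * Y1\<^sup>2 * iY\<^sup>2 - a\<^sup>2 * (iS - 2 * a\<^sup>2 * x\<^sup>2 * iS\<^sup>2))
   (2 * Y1 * iQ) (- 2 * Q * Y1 * iY\<^sup>2) (2 * Q * Y1 * iS\<^sup>2 - 4 * a\<^sup>2 * x * Q * Y * iS^3)
   (- 4 * a\<^sup>2 * x * Q\<^sup>2 * iS^3) (4 * Y * Y1 * iS\<^sup>2 - 4 * a\<^sup>2 * x * Y\<^sup>2 * iS^3)"

text \<open>Frame vectors 1 and 4 combine the t- and \<phi>-directions, on which nothing depends;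
  frame vectors 2 and 3 are the derivations by r and by x.\<close>

definition "conn_deriv D = (if D = (2::4) then conn_dr else if D = 3 then conn_dx else 0)"

definition "frame_norms = (vector [- Q * iS, S * iQ, S * iY, Y * iS] :: real^4)"

definition "frame_curvature A B C D = conn_deriv C $ A $ B $ D - conn_deriv D $ A $ B $ C
     + (\<Sum>F\<in>UNIV. conn $ A $ B $ F * (conn $ F $ C $ D - conn $ F $ D $ C))
     + (\<Sum>F\<in>UNIV. conn $ A $ F $ C * conn $ F $ B $ D - conn $ A $ F $ D * conn $ F $ B $ C)"

lemma conn_deriv_simps: "conn_deriv 1 = 0" "conn_deriv 2 = conn_dr" "conn_deriv 3 = conn_dx" "conn_deriv 4 = 0"
  by (simp_all add: conn_deriv_def)

lemmas conn_table_simps = conn_dr_def conn_dx_def conn_def kerr_connection_def kerr_connection_deriv_def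
  vector_4_index mult_zero_left mult_zero_right add_0_left add_0_right diff_0_right diff_0 minus_zero diff_self

text \<open>\<open>curv_A\<close>, \<open>curv_B\<close>, \<open>curv_N\<close> are the components 1212, 3434, 1324 of the curvature, and \<open>curv_K\<close>
  is the sectional curvature common to the planes 13, 14, 23, 24.\<close>

definition "curv_K = Q*iS^2 - a^2*Y*iS^2 - x*a^2*Y1*iS^2 - 2*x^2*a^2*Q*iS^3 + 2*x^2*a^4*Y*iS^3 - r*Q1*iS^2"
definition "curv_A = 3*Q*iS^2 + Q2*iS - 3*a^2*Y*iS^2 - 4*x^2*a^2*Q*iS^3 + 4*x^2*a^4*Y*iS^3 - 4*r*Q1*iS^2"
definition "curv_B = -Q*iS^2 - Y2*iS + a^2*Y*iS^2 + 4*x*a^2*Y1*iS^2 + 4*x^2*a^2*Q*iS^3 - 4*x^2*a^4*Y*iS^3"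
definition "curv_N = x*a*Q1*iS^2 - r*a*Y1*iS^2 - 2*r*x*a*Q*iS^3 + 2*r*x*a^3*Y*iS^3"

lemmas curv_defs = curv_K_def curv_A_def curv_B_def curv_N_def

lemmas type_D_simps = type_D_def wedge_def bivec_def index_4_neq if_True if_False simp_thms frame_norms_def mult_1_right diff_self diff_0_right diff_0

context
  assumes rels: "S * iS = 1" "Q * iQ = 1" "Y * iY = 1" "S = r\<^sup>2 + a\<^sup>2 * x\<^sup>2"
begin

text \<open>Ninety-six polynomial identities modulo \<open>rels\<close>, restricted to
  \<open>C\<close> before \<open>D\<close> by antisymmetry. The shifts by \<open>curv_K\<close>
  compensate for the term with \<open>wedge\<close>, whose components 1212 and 3434 are
  \<open>- curv_K\<close> and \<open>curv_K\<close> because the norms multiply to -1 and to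
  1.\<close>

lemma frame_curvature_less:
  assumes "(C, D) \<in> {(1, 2), (1, 3), (1, 4), (2, 3), (2, 4), (3, 4)}"
  shows "frame_norms $ A * frame_curvature A B C D = type_D (($) frame_norms) curv_K (curv_A + curv_K) (curv_B - curv_K) curv_N A B C D"
proof -
  have 1: "\<forall>A B. frame_norms $ A * frame_curvature A B 1 2 = type_D (($) frame_norms) curv_K (curv_A + curv_K) (curv_B - curv_K) curv_N A B 1 2"
    unfolding forall_4 frame_curvature_def sum_4 conn_deriv_simps zero_index
    by (intro conjI, simp_all only: conn_table_simps type_D_simps, unfold curv_defs,
        simp_all add: algebra_simps power2_eq_square power3_eq_cube, (use rels in algebra)+)
  have 2: "\<forall>A B. frame_norms $ A * frame_curvature A B 1 3 = type_D (($) frame_norms) curv_K (curv_A + curv_K) (curv_B - curv_K) curv_N A B 1 3"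
    unfolding forall_4 frame_curvature_def sum_4 conn_deriv_simps zero_index
    by (intro conjI, simp_all only: conn_table_simps type_D_simps, unfold curv_defs,
        simp_all add: algebra_simps power2_eq_square power3_eq_cube, (use rels in algebra)+)
  have 3: "\<forall>A B. frame_norms $ A * frame_curvature A B 1 4 = type_D (($) frame_norms) curv_K (curv_A + curv_K) (curv_B - curv_K) curv_N A B 1 4"
    unfolding forall_4 frame_curvature_def sum_4 conn_deriv_simps zero_index
    by (intro conjI, simp_all only: conn_table_simps type_D_simps, unfold curv_defs,
        simp_all add: algebra_simps power2_eq_square power3_eq_cube, (use rels in algebra)+)
  have 4: "\<forall>A B. frame_norms $ A * frame_curvature A B 2 3 = type_D (($) frame_norms) curv_K (curv_A + curv_K) (curv_B - curv_K) curv_N A B 2 3"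
    unfolding forall_4 frame_curvature_def sum_4 conn_deriv_simps zero_index
    by (intro conjI, simp_all only: conn_table_simps type_D_simps, unfold curv_defs,
        simp_all add: algebra_simps power2_eq_square power3_eq_cube, (use rels in algebra)+)
  have 5: "\<forall>A B. frame_norms $ A * frame_curvature A B 2 4 = type_D (($) frame_norms) curv_K (curv_A + curv_K) (curv_B - curv_K) curv_N A B 2 4"
    unfolding forall_4 frame_curvature_def sum_4 conn_deriv_simps zero_index
    by (intro conjI, simp_all only: conn_table_simps type_D_simps, unfold curv_defs,
        simp_all add: algebra_simps power2_eq_square power3_eq_cube, (use rels in algebra)+)
  have 6: "\<forall>A B. frame_norms $ A * frame_curvature A B 3 4 = type_D (($) frame_norms) curv_K (curv_A + curv_K) (curv_B - curv_K) curv_N A B 3 4"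
    unfolding forall_4 frame_curvature_def sum_4 conn_deriv_simps zero_index
    by (intro conjI, simp_all only: conn_table_simps type_D_simps, unfold curv_defs,
        simp_all add: algebra_simps power2_eq_square power3_eq_cube, (use rels in algebra)+)
  show ?thesis
    using assms 1 2 3 4 5 6 by auto
qed

lemma frame_curvature_type_D: "frame_norms $ A * frame_curvature A B C D = type_D (($) frame_norms) curv_K (curv_A + curv_K) (curv_B - curv_K) curv_N A B C D"
proof -
  have swap: "type_D h k p q v A B C D = - type_D h k p q v A B D C" "frame_curvature A B C D = - frame_curvature A B D C" for h k p q v C D
    unfolding type_D_def wedge_def bivec_def frame_curvature_def by (simp_all add: sum_subtractf algebra_simps)
  then have eq: "type_D h k p q v A B C C = 0" "frame_curvature A B C C = 0" for h k p q v C
    by (metis add.inverse_neutral neg_equal_zero)+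
  consider "C = D" | "(C, D) \<in> {(1, 2), (1, 3), (1, 4), (2, 3), (2, 4), (3, 4)}"
    | "(D, C) \<in> {(1, 2), (1, 3), (1, 4), (2, 3), (2, 4), (3, 4)}"
    using exhaust_4[of C] exhaust_4[of D] by auto
  then show ?thesis
  proof cases
    case 3
    from frame_curvature_less[OF this, of A B] show ?thesis
      unfolding swap(1)[of _ _ _ _ _ C D] swap(2)[of C D] by simp
  qed (simp_all add: frame_curvature_less eq)
qed

end

end

text \<open>Over the common denominator \<open>S^3\<close> only polynomials in r and x have to be
  compared. The terms with \<open>\<kappa>\<close> collect to a multiple of \<open>S^3\<close>,
  hence to a constant; those with \<open>m\<close> form the real and imaginary parts of m (r + i a
  x)^3.\<close>

lemma curv_kerr_de_sitter:
  fixes a r x m \<kappa> S iS :: real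
  assumes iS: "S * iS = 1" and S: "S = r\<^sup>2 + a\<^sup>2 * x\<^sup>2"
    and Q: "Q = a\<^sup>2 - 2 * m * r + r\<^sup>2 - \<kappa> * (a\<^sup>2 + r\<^sup>2) * r\<^sup>2" "Q1 = r - m - \<kappa> * (a\<^sup>2 * r + 2 * r^3)"
      "Q2 = 1 - \<kappa> * (a\<^sup>2 + 6 * r\<^sup>2)"
    and Y: "Y = (1 + \<kappa> * a\<^sup>2 * x\<^sup>2) * (1 - x\<^sup>2)" "Y1 = - x + \<kappa> * a\<^sup>2 * (x - 2 * x^3)"
      "Y2 = - 1 + \<kappa> * a\<^sup>2 * (1 - 6 * x\<^sup>2)"
    and p: "p = m * r * (3 * a\<^sup>2 * x\<^sup>2 - r\<^sup>2) * iS^3" and v: "v = m * a * x * (3 * r\<^sup>2 - a\<^sup>2 * x\<^sup>2) * iS^3"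
  shows "curv_K a r x Q Q1 Y Y1 iS = p + \<kappa>" "curv_A a r x Q Q1 Q2 Y iS = 2 * p - \<kappa>"
    "curv_B a x Q Y Y1 Y2 iS = \<kappa> - 2 * p" "curv_N a r x Q Q1 Y Y1 iS = v"
proof -
  have iS1: "iS = S^2 * iS^3" and iS2: "iS^2 = S * iS^3" and \<kappa>: "\<kappa> = \<kappa> * S^3 * iS^3"
    using iS by algebra+
  have "curv_K a r x Q Q1 Y Y1 iS = (Q*S - a^2*Y*S - x*a^2*Y1*S - 2*x^2*a^2*Q + 2*x^2*a^4*Y - r*Q1*S) * iS^3"
    unfolding curv_K_def iS2 by algebra
  also have "Q*S - a^2*Y*S - x*a^2*Y1*S - 2*x^2*a^2*Q + 2*x^2*a^4*Y - r*Q1*S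
      = m * r * (3 * a\<^sup>2 * x\<^sup>2 - r\<^sup>2) + \<kappa> * S^3"
    unfolding Q Y S by algebra
  finally show "curv_K a r x Q Q1 Y Y1 iS = p + \<kappa>"
    unfolding p by (subst \<kappa>) (simp add: algebra_simps)
  have "curv_A a r x Q Q1 Q2 Y iS = (3*Q*S + Q2*S^2 - 3*a^2*Y*S - 4*x^2*a^2*Q + 4*x^2*a^4*Y - 4*r*Q1*S) * iS^3"
    unfolding curv_A_def iS2 by (subst iS1) algebra
  also have "3*Q*S + Q2*S^2 - 3*a^2*Y*S - 4*x^2*a^2*Q + 4*x^2*a^4*Y - 4*r*Q1*S
      = 2 * m * r * (3 * a\<^sup>2 * x\<^sup>2 - r\<^sup>2) - \<kappa> * S^3"
    unfolding Q Y S by algebra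
  finally show "curv_A a r x Q Q1 Q2 Y iS = 2 * p - \<kappa>"
    unfolding p by (subst \<kappa>) (simp add: algebra_simps)
  have "curv_B a x Q Y Y1 Y2 iS = (- Q*S - Y2*S^2 + a^2*Y*S + 4*x*a^2*Y1*S + 4*x^2*a^2*Q - 4*x^2*a^4*Y) * iS^3"
    unfolding curv_B_def iS2 by (subst iS1) algebra
  also have "- Q*S - Y2*S^2 + a^2*Y*S + 4*x*a^2*Y1*S + 4*x^2*a^2*Q - 4*x^2*a^4*Y
      = \<kappa> * S^3 - 2 * m * r * (3 * a\<^sup>2 * x\<^sup>2 - r\<^sup>2)"
    unfolding Q Y S by algebra
  finally show "curv_B a x Q Y Y1 Y2 iS = \<kappa> - 2 * p"
    unfolding p by (subst \<kappa>) (simp add: algebra_simps)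
  have "curv_N a r x Q Q1 Y Y1 iS = (x*a*Q1*S - r*a*Y1*S - 2*r*x*a*Q + 2*r*x*a^3*Y) * iS^3"
    unfolding curv_N_def iS2 by algebra
  also have "x*a*Q1*S - r*a*Y1*S - 2*r*x*a*Q + 2*r*x*a^3*Y = m * a * x * (3 * r\<^sup>2 - a\<^sup>2 * x\<^sup>2)"
    unfolding Q Y S by algebra
  finally show "curv_N a r x Q Q1 Y Y1 iS = v"
    unfolding v .
qed

lemma kerr_connection_partial:
  assumes "has_partial i b db y" "has_partial i d dd y" "has_partial i u du y" "has_partial i w dw y"
    "has_partial i k dk y" "has_partial i k' dk' y" "has_partial i n dn y" "has_partial i p dp y" "has_partial i q dq y"
  shows "has_partial i (\<lambda>y. kerr_connection a (b y) (d y) (u y) (w y) (k y) (k' y) (n y) (p y) (q y) $ A $ B $ C)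
    (kerr_connection_deriv a (b y) (d y) (u y) (w y) (k y) (k' y) (n y) (p y) (q y)
      db dd du dw dk dk' dn dp dq $ A $ B $ C) y"
proof -
  have "\<forall>A B C. has_partial i (\<lambda>y. kerr_connection a (b y) (d y) (u y) (w y) (k y) (k' y) (n y) (p y) (q y) $ A $ B $ C)
    (kerr_connection_deriv a (b y) (d y) (u y) (w y) (k y) (k' y) (n y) (p y) (q y)
      db dd du dw dk dk' dn dp dq $ A $ B $ C) y"
    unfolding forall_4 kerr_connection_def kerr_connection_deriv_def
    by (intro conjI, simp_all only: vector_4_index, (rule has_partial_eqI, (rule assms has_partial_intros)+, simp)+)
  then show ?thesis by blast
qed

lemma kerr_connection_deriv_linear:
  "kerr_connection_deriv a b d u w k k' n p q (s * db + t * db') (s * dd + t * dd') (s * du + t * du') (s * dw + t * dw')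
     (s * dk + t * dk') (s * dl + t * dl') (s * dn + t * dn') (s * dp + t * dp') (s * dq + t * dq') $ A $ B $ C
   = s * kerr_connection_deriv a b d u w k k' n p q db dd du dw dk dl dn dp dq $ A $ B $ C
   + t * kerr_connection_deriv a b d u w k k' n p q db' dd' du' dw' dk' dl' dn' dp' dq' $ A $ B $ C"
   (is "?L A B C = ?R A B C")
proof -
  have "\<forall>A B C. ?L A B C = ?R A B C"
    unfolding forall_4 kerr_connection_deriv_def
    by (intro conjI, simp_all only: vector_4_index, simp_all add: algebra_simps)
  then show ?thesis by blast
qed

text \<open>The chain rule through r and x. The factors 2 are there because \<open>Q1\<close> and
  \<open>Y1\<close> are halves of derivatives.\<close>

lemma conn_partial:
  assumes P: "has_partial k r rk y" "has_partial k x xk y"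
    "has_partial k Q (2 * Q1 y * rk) y" "has_partial k Q1 (Q2 * rk) y"
    "has_partial k Y (2 * Y1 y * xk) y" "has_partial k Y1 (Y2 * xk) y"
    "has_partial k iS (- (iS y)\<^sup>2 * (2 * r y * rk + 2 * a\<^sup>2 * x y * xk)) y"
    "has_partial k iQ (- (iQ y)\<^sup>2 * (2 * Q1 y * rk)) y"
    "has_partial k iY (- (iY y)\<^sup>2 * (2 * Y1 y * xk)) y"
  shows "has_partial k (\<lambda>y. conn a (r y) (x y) (Q y) (Q1 y) (Y y) (Y1 y) (iS y) (iQ y) (iY y) $ A $ B $ C)
    (rk * conn_dr a (r y) (x y) (Q y) (Q1 y) Q2 (Y y) (Y1 y) (iS y) (iQ y) (iY y) $ A $ B $ C
     + xk * conn_dx a (r y) (x y) (Q y) (Q1 y) (Y y) (Y1 y) Y2 (iS y) (iQ y) (iY y) $ A $ B $ C) y"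
  unfolding conn_def conn_dr_def conn_dx_def kerr_connection_deriv_linear[symmetric]
  by (rule kerr_connection_partial; rule has_partial_eqI, (rule P has_partial_intros)+, algebra)

subsection \<open>The Kerr-de Sitter metric\<close>

lemmas kerr_table_simps = vector_4_index index_4_neq if_True if_False simp_thms sum_4 mult_zero_left mult_zero_right
  add_0_left add_0_right diff_0_right diff_0 minus_zero diff_self mult_1_left mult_1_right

context
  fixes a \<Lambda> m \<sigma> :: real
begin

definition kerr_Q1 :: "real \<Rightarrow> real" where
  "kerr_Q1 r = r - m - (\<Lambda> / 3) * (a\<^sup>2 * r + 2 * r^3)"

definition kerr_Q2 :: "real \<Rightarrow> real" where
  "kerr_Q2 r = 1 - (\<Lambda> / 3) * (a\<^sup>2 + 6 * r\<^sup>2)"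

text \<open>This is P sin^2 \<theta> as a polynomial in x = cos \<theta>, since d\<theta>^2/P =
  dx^2/Y.\<close>

definition kerr_Y :: "real \<Rightarrow> real" where
  "kerr_Y x = (1 + (\<Lambda> / 3) * a\<^sup>2 * x\<^sup>2) * (1 - x\<^sup>2)"

definition kerr_Y1 :: "real \<Rightarrow> real" where
  "kerr_Y1 x = - x + (\<Lambda> / 3) * a\<^sup>2 * (x - 2 * x^3)"

definition kerr_Y2 :: "real \<Rightarrow> real" where
  "kerr_Y2 x = - 1 + (\<Lambda> / 3) * a\<^sup>2 * (1 - 6 * x\<^sup>2)"

text \<open>The factor \<open>\<sigma>\<close> fixes the sign of \<open>sin \<theta>\<close>, hence the orientation of the frame.\<close>

definition kerr_domain :: "(real^4) set" where
  "kerr_domain = {y. kerr_rho2 a (y$2) (y$3) \<noteq> 0 \<and> kerr_Q a \<Lambda> m (y$2) \<noteq> 0 \<and> kerr_P a \<Lambda> (y$3) > 0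
     \<and> \<sigma> * sin (y$3) > 0}"

definition kerr_e :: "real^4 \<Rightarrow> real^4^4" where
  "kerr_e y = vector
    [vector [1, 0, 0, - a * (1 - (cos (y$3))\<^sup>2)],
     vector [0, 1, 0, 0],
     vector [0, 0, - sin (y$3), 0],
     vector [a, 0, 0, - ((y$2)\<^sup>2 + a\<^sup>2)]]"

definition kerr_de :: "4 \<Rightarrow> real^4 \<Rightarrow> real^4^4" where
  "kerr_de k y = vector
    [vector [0, 0, 0, if k = 3 then - 2 * a * cos (y$3) * sin (y$3) else 0],
     vector [0, 0, 0, 0],
     vector [0, 0, if k = 3 then - cos (y$3) else 0, 0],
     vector [0, 0, 0, if k = 2 then - 2 * (y$2) else 0]]"

definition kerr_dde :: "4 \<Rightarrow> 4 \<Rightarrow> real^4 \<Rightarrow> real^4^4" where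
  "kerr_dde k l y = vector
    [vector [0, 0, 0, if k = 3 \<and> l = 3 then - 2 * a * ((cos (y$3))\<^sup>2 - (sin (y$3))\<^sup>2) else 0],
     vector [0, 0, 0, 0],
     vector [0, 0, if k = 3 \<and> l = 3 then sin (y$3) else 0, 0],
     vector [0, 0, 0, if k = 2 \<and> l = 2 then - 2 else 0]]"

text \<open>The inverse of \<open>kerr_e\<close>: its block in t and \<phi> has determinant -(r^2 +
  a^2) + a^2 (1 - x^2), which is minus \<open>kerr_rho2\<close>.\<close>

definition kerr_E :: "real^4 \<Rightarrow> real^4^4" where
  "kerr_E y = vector
    [vector [((y$2)\<^sup>2 + a\<^sup>2) * inverse (kerr_rho2 a (y$2) (y$3)), 0, 0,
       - a * (1 - (cos (y$3))\<^sup>2) * inverse (kerr_rho2 a (y$2) (y$3))],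
     vector [0, 1, 0, 0],
     vector [0, 0, - inverse (sin (y$3)), 0],
     vector [a * inverse (kerr_rho2 a (y$2) (y$3)), 0, 0, - inverse (kerr_rho2 a (y$2) (y$3))]]"

definition kerr_h :: "real^4 \<Rightarrow> real^4" where
  "kerr_h y = frame_norms (kerr_Q a \<Lambda> m (y$2)) (kerr_Y (cos (y$3))) (kerr_rho2 a (y$2) (y$3))
     (inverse (kerr_rho2 a (y$2) (y$3))) (inverse (kerr_Q a \<Lambda> m (y$2))) (inverse (kerr_Y (cos (y$3))))"

definition kerr_\<gamma> :: "real^4 \<Rightarrow> real^4^4^4" where
  "kerr_\<gamma> y = conn a (y$2) (cos (y$3)) (kerr_Q a \<Lambda> m (y$2)) (kerr_Q1 (y$2)) (kerr_Y (cos (y$3))) (kerr_Y1 (cos (y$3)))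
     (inverse (kerr_rho2 a (y$2) (y$3))) (inverse (kerr_Q a \<Lambda> m (y$2))) (inverse (kerr_Y (cos (y$3))))"

definition kerr_d\<gamma> :: "4 \<Rightarrow> real^4 \<Rightarrow> real^4^4^4" where
  "kerr_d\<gamma> D y = conn_deriv a (y$2) (cos (y$3)) (kerr_Q a \<Lambda> m (y$2)) (kerr_Q1 (y$2)) (kerr_Q2 (y$2))
     (kerr_Y (cos (y$3))) (kerr_Y1 (cos (y$3))) (kerr_Y2 (cos (y$3)))
     (inverse (kerr_rho2 a (y$2) (y$3))) (inverse (kerr_Q a \<Lambda> m (y$2))) (inverse (kerr_Y (cos (y$3)))) D"

lemma open_kerr_domain: "open kerr_domain"
  unfolding kerr_domain_def kerr_rho2_def kerr_Q_def kerr_P_def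
  by (intro open_Collect_conj open_Collect_neq open_Collect_less continuous_intros)

lemma kerr_domainD:
  assumes "y \<in> kerr_domain"
  shows "kerr_rho2 a (y$2) (y$3) \<noteq> 0" "kerr_Q a \<Lambda> m (y$2) \<noteq> 0" "kerr_Y (cos (y$3)) \<noteq> 0" "sin (y$3) \<noteq> 0"
    "kerr_Y (cos (y$3)) = kerr_P a \<Lambda> (y$3) * (sin (y$3))\<^sup>2" "\<sigma> * sin (y$3) > 0"
proof -
  show eq: "kerr_Y (cos (y$3)) = kerr_P a \<Lambda> (y$3) * (sin (y$3))\<^sup>2"
    by (simp add: kerr_Y_def kerr_P_def sin_squared_eq)
  show "kerr_rho2 a (y$2) (y$3) \<noteq> 0" "kerr_Q a \<Lambda> m (y$2) \<noteq> 0" "\<sigma> * sin (y$3) > 0"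
    using assms by (auto simp: kerr_domain_def)
  then show s: "sin (y$3) \<noteq> 0"
    by auto
  show "kerr_Y (cos (y$3)) \<noteq> 0"
    unfolding eq using assms s by (auto simp: kerr_domain_def)
qed

lemma kerr_rels:
  assumes "y \<in> kerr_domain"
  shows "kerr_rho2 a (y$2) (y$3) * inverse (kerr_rho2 a (y$2) (y$3)) = 1"
    "kerr_Q a \<Lambda> m (y$2) * inverse (kerr_Q a \<Lambda> m (y$2)) = 1"
    "kerr_Y (cos (y$3)) * inverse (kerr_Y (cos (y$3))) = 1"
    "kerr_rho2 a (y$2) (y$3) = (y$2)\<^sup>2 + a\<^sup>2 * (cos (y$3))\<^sup>2"
  by (rule right_inverse kerr_domainD[OF assms])+ (simp add: kerr_rho2_def)

lemma kerr_partials: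
  assumes y: "y \<in> kerr_domain"
  defines "rk k \<equiv> (if k = 2 then 1 else 0)" and "xk k \<equiv> (if k = 3 then - sin (y$3) else 0)"
  shows "has_partial k (\<lambda>y. y$2) (rk k) y" "has_partial k (\<lambda>y. cos (y$3)) (xk k) y"
    "has_partial k (\<lambda>y. kerr_Q a \<Lambda> m (y$2)) (2 * kerr_Q1 (y$2) * rk k) y"
    "has_partial k (\<lambda>y. kerr_Q1 (y$2)) (kerr_Q2 (y$2) * rk k) y"
    "has_partial k (\<lambda>y. kerr_Y (cos (y$3))) (2 * kerr_Y1 (cos (y$3)) * xk k) y"
    "has_partial k (\<lambda>y. kerr_Y1 (cos (y$3))) (kerr_Y2 (cos (y$3)) * xk k) y"
    "has_partial k (\<lambda>y. kerr_rho2 a (y$2) (y$3)) (2 * (y$2) * rk k + 2 * a\<^sup>2 * cos (y$3) * xk k) y"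
    "has_partial k (\<lambda>y. inverse (kerr_rho2 a (y$2) (y$3)))
       (- (inverse (kerr_rho2 a (y$2) (y$3)))\<^sup>2 * (2 * (y$2) * rk k + 2 * a\<^sup>2 * cos (y$3) * xk k)) y"
    "has_partial k (\<lambda>y. inverse (kerr_Q a \<Lambda> m (y$2)))
       (- (inverse (kerr_Q a \<Lambda> m (y$2)))\<^sup>2 * (2 * kerr_Q1 (y$2) * rk k)) y"
    "has_partial k (\<lambda>y. inverse (kerr_Y (cos (y$3))))
       (- (inverse (kerr_Y (cos (y$3))))\<^sup>2 * (2 * kerr_Y1 (cos (y$3)) * xk k)) y"
proof -
  note d = kerr_domainD[OF y]
  show r: "has_partial k (\<lambda>y. y$2) (rk k) y"
    unfolding rk_def using has_partial_coord[of k 2 y] by (simp add: eq_commute)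
  have "has_partial k (\<lambda>y. cos (y$3)) (- sin (y$3) * (if k = 3 then 1 else 0)) y"
    by (intro has_partial_compose[where F = cos] has_partial_coord) (auto intro!: derivative_eq_intros)
  then show x: "has_partial k (\<lambda>y. cos (y$3)) (xk k) y"
    by (rule has_partial_eqI) (simp add: xk_def)
  show Q: "has_partial k (\<lambda>y. kerr_Q a \<Lambda> m (y$2)) (2 * kerr_Q1 (y$2) * rk k) y"
    by (intro has_partial_compose r) (auto intro!: derivative_eq_intros simp: kerr_Q_def kerr_Q1_def algebra_simps power2_eq_square power3_eq_cube)
  show "has_partial k (\<lambda>y. kerr_Q1 (y$2)) (kerr_Q2 (y$2) * rk k) y"
    by (intro has_partial_compose r) (auto intro!: derivative_eq_intros simp: kerr_Q1_def kerr_Q2_def algebra_simps power2_eq_square power3_eq_cube)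
  show Y: "has_partial k (\<lambda>y. kerr_Y (cos (y$3))) (2 * kerr_Y1 (cos (y$3)) * xk k) y"
    unfolding kerr_Y_def[abs_def]
    by (intro has_partial_compose[where f = "\<lambda>y. cos (y$3)"] x) (auto intro!: derivative_eq_intros simp: kerr_Y_def kerr_Y1_def field_simps power2_eq_square power3_eq_cube)
  show "has_partial k (\<lambda>y. kerr_Y1 (cos (y$3))) (kerr_Y2 (cos (y$3)) * xk k) y"
    unfolding kerr_Y1_def[abs_def]
    by (intro has_partial_compose[where f = "\<lambda>y. cos (y$3)"] x) (auto intro!: derivative_eq_intros simp: kerr_Y1_def kerr_Y2_def field_simps power2_eq_square power3_eq_cube)
  show S: "has_partial k (\<lambda>y. kerr_rho2 a (y$2) (y$3)) (2 * (y$2) * rk k + 2 * a\<^sup>2 * cos (y$3) * xk k) y"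
    unfolding kerr_rho2_def
    by (rule has_partial_eqI, (rule r x has_partial_intros)+) simp
  show "has_partial k (\<lambda>y. inverse (kerr_rho2 a (y$2) (y$3)))
       (- (inverse (kerr_rho2 a (y$2) (y$3)))\<^sup>2 * (2 * (y$2) * rk k + 2 * a\<^sup>2 * cos (y$3) * xk k)) y"
    by (rule has_partial_inverse[OF S d(1)])
  show "has_partial k (\<lambda>y. inverse (kerr_Q a \<Lambda> m (y$2)))
       (- (inverse (kerr_Q a \<Lambda> m (y$2)))\<^sup>2 * (2 * kerr_Q1 (y$2) * rk k)) y"
    by (rule has_partial_inverse[OF Q d(2)])
  show "has_partial k (\<lambda>y. inverse (kerr_Y (cos (y$3))))
       (- (inverse (kerr_Y (cos (y$3))))\<^sup>2 * (2 * kerr_Y1 (cos (y$3)) * xk k)) y"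
    by (rule has_partial_inverse[OF Y d(3)])
qed

lemma kerr_moving_frame:
  "moving_frame kerr_domain (kerr_ds_metric a \<Lambda> m) (\<lambda>A i y. kerr_e y $ A $ i) (\<lambda>i A y. kerr_E y $ i $ A)
     (\<lambda>A y. kerr_h y $ A) (\<lambda>A B C y. kerr_\<gamma> y $ A $ B $ C) (\<lambda>A B C D y. kerr_d\<gamma> D y $ A $ B $ C)
     (\<lambda>A i k y. kerr_de k y $ A $ i) (\<lambda>A i k l y. kerr_dde k l y $ A $ i)"
proof
  show "open kerr_domain" by (rule open_kerr_domain)
next
  fix y :: "real^4" assume y: "y \<in> kerr_domain"
  note d = kerr_domainD[OF y] and rels = kerr_rels[OF y]
  fix i j k l A B C :: 4
  have cos: "1 - (cos (y$3))\<^sup>2 = (sin (y$3))\<^sup>2"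
    by (simp add: sin_squared_eq)
  \<comment> \<open>The frame yields (rho^2/Y) sin^2 \<theta> for the d\<theta>^2 coefficient; with
    Y = P sin^2 \<theta> this cancellation leaves rho^2/P.\<close>
  have ss: "sin (y$3) * (sin (y$3) * (inverse (sin (y$3)) * inverse (sin (y$3)))) = 1"
    using d(4) by (simp add: field_simps)
  have "\<forall>i j. kerr_ds_metric a \<Lambda> m y $ i $ j = (\<Sum>A\<in>UNIV. kerr_h y $ A * kerr_e y $ A $ i * kerr_e y $ A $ j)"
    unfolding forall_4 kerr_ds_metric_def Let_def kerr_h_def kerr_e_def frame_norms_def sum_4 vec_lambda_beta
    by (intro conjI; simp only: kerr_table_simps vector_minus_component vector_scaleR_component axis_nth_4 cos)
      (use d(1-4) in \<open>simp_all add: d(5) ss divide_inverse power2_eq_square algebra_simps\<close>)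
  then show "kerr_ds_metric a \<Lambda> m y $ i $ j = (\<Sum>A\<in>UNIV. kerr_h y $ A * kerr_e y $ A $ i * kerr_e y $ A $ j)"
    by blast
  have "\<forall>A. kerr_h y $ A \<noteq> 0"
    unfolding forall_4 kerr_h_def frame_norms_def vector_4_index using d(1-3) by simp
  then show "kerr_h y $ A \<noteq> 0" by blast
  \<comment> \<open>With trigonometric functions and inverses named as atoms, the duality and
    structure equations become polynomial and lie within reach of \<open>algebra\<close>.\<close>
  define r where "r = y$2"
  define \<theta> where "\<theta> = y$3"
  define c where "c = cos \<theta>"
  define s where "s = sin \<theta>"
  define S where "S = kerr_rho2 a r \<theta>"
  define Q where "Q = kerr_Q a \<Lambda> m r"
  define Q1 where "Q1 = kerr_Q1 r"
  define Y where "Y = kerr_Y c"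
  define Y1 where "Y1 = kerr_Y1 c"
  define iS where "iS = inverse S"
  define iQ where "iQ = inverse Q"
  define iY where "iY = inverse Y"
  define s' where "s' = inverse s"
  note fold = r_def[symmetric] \<theta>_def[symmetric] c_def[symmetric] s_def[symmetric] S_def[symmetric]
    Q_def[symmetric] Q1_def[symmetric] Y_def[symmetric] Y1_def[symmetric]
    iS_def[symmetric] iQ_def[symmetric] iY_def[symmetric] s'_def[symmetric]
  have s: "s' * s = 1"
    unfolding s'_def s_def \<theta>_def using d(4) by simp
  note rels' = rels[unfolded fold]
  have "\<forall>i j. (\<Sum>A\<in>UNIV. kerr_E y $ i $ A * kerr_e y $ A $ j) = (if i = j then 1 else 0)"
    unfolding forall_4 kerr_E_def kerr_e_def fold
    by (intro conjI, simp_all only: kerr_table_simps, simp_all add: algebra_simps power2_eq_square, (use s rels' in algebra)+)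
  then show "(\<Sum>A\<in>UNIV. kerr_E y $ i $ A * kerr_e y $ A $ j) = (if i = j then 1 else 0)" by blast
  have "\<forall>A B. (\<Sum>i\<in>UNIV. kerr_e y $ A $ i * kerr_E y $ i $ B) = (if A = B then 1 else 0)"
    unfolding forall_4 kerr_E_def kerr_e_def fold
    by (intro conjI, simp_all only: kerr_table_simps, simp_all add: algebra_simps power2_eq_square, (use s rels' in algebra)+)
  then show "(\<Sum>i\<in>UNIV. kerr_e y $ A $ i * kerr_E y $ i $ B) = (if A = B then 1 else 0)" by blast
  note P = kerr_partials[OF y, of k] has_partial_sin has_partial_inverse[OF has_partial_sin d(4)]
  have "\<forall>i A. \<exists>d. has_partial k (\<lambda>y. kerr_E y $ i $ A) d y"
    unfolding forall_4 kerr_E_def vector_4_index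
    by (intro conjI; rule exI, (rule P has_partial_intros)+)
  then show "\<exists>d. has_partial k (\<lambda>y. kerr_E y $ i $ A) d y" by blast
  have "\<forall>A i. has_partial k (\<lambda>y. kerr_e y $ A $ i) (kerr_de k y $ A $ i) y"
    unfolding forall_4 kerr_e_def kerr_de_def vector_4_index
    by (intro conjI; rule has_partial_eqI, (rule P has_partial_intros)+, simp)
  then show "has_partial k (\<lambda>y. kerr_e y $ A $ i) (kerr_de k y $ A $ i) y" by blast
  have "\<forall>A i. has_partial l (\<lambda>y. kerr_de k y $ A $ i) (kerr_dde k l y $ A $ i) y"
    unfolding forall_4 kerr_de_def kerr_dde_def vector_4_index
    by (intro conjI; rule has_partial_eqI,
        (rule has_partial_if has_partial_cos has_partial_sin has_partial_coord has_partial_intros)+,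
        simp add: power2_eq_square algebra_simps)
  then show "has_partial l (\<lambda>y. kerr_de k y $ A $ i) (kerr_dde k l y $ A $ i) y" by blast
  show "kerr_dde k l y $ A $ i = kerr_dde l k y $ A $ i"
    unfolding kerr_dde_def by (simp add: conj_commute)
  define rk where "rk = (if k = 2 then 1 else (0::real))"
  define xk where "xk = (if k = 3 then - sin (y$3) else 0)"
  note P' = kerr_partials[OF y, of k, folded rk_def xk_def]
  have e23: "kerr_e y $ 2 $ k = rk" "kerr_e y $ 3 $ k = xk"
    unfolding rk_def xk_def using exhaust_4[of k] by (auto simp: kerr_e_def vector_4_index)
  \<comment> \<open>The diagonal coefficients vanish along covectors 1 and 4, in accordance with
    norms that depend on r and \<theta> only.\<close>
  have "\<forall>A. (\<Sum>C\<in>UNIV. kerr_\<gamma> y $ A $ A $ C * kerr_e y $ C $ k) = kerr_\<gamma> y $ A $ A $ 2 * rk + kerr_\<gamma> y $ A $ A $ 3 * xk"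
    unfolding forall_4 sum_4 e23 by (simp add: kerr_\<gamma>_def conn_def kerr_connection_def vector_4_index)
  then have G: "(\<Sum>C\<in>UNIV. kerr_\<gamma> y $ A $ A $ C * kerr_e y $ C $ k) = kerr_\<gamma> y $ A $ A $ 2 * rk + kerr_\<gamma> y $ A $ A $ 3 * xk" for A
    by blast
  have "\<forall>A. has_partial k (\<lambda>y. kerr_h y $ A) (2 * kerr_h y $ A * (\<Sum>C\<in>UNIV. kerr_\<gamma> y $ A $ A $ C * kerr_e y $ C $ k)) y"
    unfolding G unfolding forall_4 kerr_h_def kerr_\<gamma>_def frame_norms_def conn_def kerr_connection_def vector_4_index
    by (intro conjI; rule has_partial_eqI, (rule P' has_partial_intros)+, unfold fold, use rels' in algebra)
  then show "has_partial k (\<lambda>y. kerr_h y $ A) (2 * kerr_h y $ A * (\<Sum>C\<in>UNIV. kerr_\<gamma> y $ A $ A $ C * kerr_e y $ C $ k)) y"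
    by blast
  have "\<forall>A B C. A \<noteq> B \<longrightarrow> kerr_h y $ A * kerr_\<gamma> y $ A $ B $ C = - (kerr_h y $ B * kerr_\<gamma> y $ B $ A $ C)"
    unfolding forall_4 kerr_h_def kerr_\<gamma>_def frame_norms_def conn_def kerr_connection_def fold
    by (intro conjI, simp_all only: kerr_table_simps, simp_all add: algebra_simps power2_eq_square, (use rels' in algebra)+)
  then show "A \<noteq> B \<Longrightarrow> kerr_h y $ A * kerr_\<gamma> y $ A $ B $ C = - (kerr_h y $ B * kerr_\<gamma> y $ B $ A $ C)"
    by blast
  have "\<forall>A l k. kerr_de k y $ A $ l - kerr_de l y $ A $ k =
      (\<Sum>B\<in>UNIV. \<Sum>C\<in>UNIV. (kerr_\<gamma> y $ A $ B $ C - kerr_\<gamma> y $ A $ C $ B) * kerr_e y $ B $ k * kerr_e y $ C $ l)"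
    unfolding forall_4 kerr_de_def kerr_\<gamma>_def kerr_e_def conn_def kerr_connection_def fold
    by (intro conjI, simp_all only: kerr_table_simps, simp_all add: algebra_simps power2_eq_square, (use rels' in algebra)+)
  then show "kerr_de k y $ A $ l - kerr_de l y $ A $ k =
      (\<Sum>B\<in>UNIV. \<Sum>C\<in>UNIV. (kerr_\<gamma> y $ A $ B $ C - kerr_\<gamma> y $ A $ C $ B) * kerr_e y $ B $ k * kerr_e y $ C $ l)"
    by blast
  show "has_partial k (\<lambda>y. kerr_\<gamma> y $ A $ B $ C) (\<Sum>D\<in>UNIV. kerr_d\<gamma> D y $ A $ B $ C * kerr_e y $ D $ k) y"
  proof -
    have "(\<Sum>D\<in>UNIV. kerr_d\<gamma> D y $ A $ B $ C * kerr_e y $ D $ k) =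
       kerr_e y $ 2 $ k * kerr_d\<gamma> 2 y $ A $ B $ C + kerr_e y $ 3 $ k * kerr_d\<gamma> 3 y $ A $ B $ C"
      by (simp add: sum_4 kerr_d\<gamma>_def conn_deriv_simps)
    then show ?thesis
      unfolding kerr_\<gamma>_def kerr_d\<gamma>_def conn_deriv_simps
      using conn_partial[OF P'(1-6,8-10), where A = A and B = B and C = C] by (simp add: e23)
  qed
qed

end

subsection \<open>The Weyl invariants\<close>

text \<open>The hypotheses on \<open>c\<close>, the inverse of \<open>h\<close>, encode h1 h2 = -1
  and h3 h4 = 1. Every weight is then a power of \<open>h 1\<close> or \<open>h 3\<close> and
  cancels in the contractions. The constant 192 is twice 96 because the factor 1/2 of the dual is
  still missing.\<close>

lemma
  fixes h c :: "4 \<Rightarrow> real" and p v :: real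
  assumes h: "h 2 = - c 1" "h 4 = c 3" "c 2 = - h 1" "c 4 = h 3" "h 1 * c 1 = 1" "h 3 * c 3 = 1"
  defines "W \<equiv> type_D h p (3 * p) (- 3 * p) v"
  shows type_D_traceless: "(\<Sum>A\<in>UNIV. W A B A D * c A) = 0"
    and type_D_square: "(\<Sum>A\<in>UNIV. \<Sum>B\<in>UNIV. \<Sum>C\<in>UNIV. \<Sum>D\<in>UNIV.
      W A B C D * W A B C D * (c A * c B * c C * c D)) = 48 * (p\<^sup>2 - v\<^sup>2)"
    and type_D_dual: "(\<Sum>A\<in>UNIV. \<Sum>B\<in>UNIV. \<Sum>C\<in>UNIV. \<Sum>D\<in>UNIV.
      (\<Sum>E\<in>UNIV. \<Sum>F\<in>UNIV. eps A B E F * W E F C D * (c E * c F)) * W A B C D * (c A * c B * c C * c D))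
      = 192 * p * v"
proof -
  have nz: "h 1 \<noteq> 0" "h 3 \<noteq> 0"
    using h(5,6) by auto
  then have c: "c 1 = 1 / h 1" "c 3 = 1 / h 3"
    using h(5,6) by (simp_all add: eq_divide_eq mult.commute)
  have "\<forall>B D. (\<Sum>A\<in>UNIV. W A B A D * c A) = 0"
    unfolding forall_4 W_def type_D_def wedge_def bivec_def sum_4
    by (intro conjI, simp_all only: kerr_table_simps, simp_all add: h(1-4), (use h(5,6) in algebra)+)
  then show "(\<Sum>A\<in>UNIV. W A B A D * c A) = 0" by blast
  show "(\<Sum>A\<in>UNIV. \<Sum>B\<in>UNIV. \<Sum>C\<in>UNIV. \<Sum>D\<in>UNIV.
      W A B C D * W A B C D * (c A * c B * c C * c D)) = 48 * (p\<^sup>2 - v\<^sup>2)"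
    unfolding W_def type_D_def wedge_def bivec_def sum_4
    by (simp only: kerr_table_simps h(1-4) c) (use nz in \<open>simp add: field_simps power2_eq_square\<close>)
  have dual: "(\<Sum>E\<in>UNIV. \<Sum>F\<in>UNIV. eps A B E F * W E F C D * (c E * c F)) =
      (\<Sum>E\<in>UNIV. \<Sum>F\<in>UNIV. eps A B E F * (W E F C D * (c E * c F)))" for A B C D
    by (simp add: mult.assoc)
  show "(\<Sum>A\<in>UNIV. \<Sum>B\<in>UNIV. \<Sum>C\<in>UNIV. \<Sum>D\<in>UNIV.
      (\<Sum>E\<in>UNIV. \<Sum>F\<in>UNIV. eps A B E F * W E F C D * (c E * c F)) * W A B C D * (c A * c B * c C * c D))
      = 192 * p * v"
    unfolding dual eps_values unfolding W_def type_D_def wedge_def bivec_def sum_4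
    by (simp only: kerr_table_simps h(1-4) c) (use nz in \<open>simp add: field_simps power2_eq_square\<close>)
qed

context
  fixes a \<Lambda> m \<sigma> :: real
begin

text \<open>\<open>kerr_p - i kerr_v = - m / (r - i a cos \<theta>)\<^sup>3\<close>\<close>

definition kerr_p :: "real^4 \<Rightarrow> real" where
  "kerr_p y = m * (y$2) * (3 * a\<^sup>2 * (cos (y$3))\<^sup>2 - (y$2)\<^sup>2) * inverse (kerr_rho2 a (y$2) (y$3)) ^ 3"

definition kerr_v :: "real^4 \<Rightarrow> real" where
  "kerr_v y = m * a * cos (y$3) * (3 * (y$2)\<^sup>2 - a\<^sup>2 * (cos (y$3))\<^sup>2) * inverse (kerr_rho2 a (y$2) (y$3)) ^ 3"

definition kerr_weyl :: "real^4 \<Rightarrow> 4 \<Rightarrow> 4 \<Rightarrow> 4 \<Rightarrow> 4 \<Rightarrow> real" where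
  "kerr_weyl y = type_D (($) (kerr_h a \<Lambda> m y)) (kerr_p y) (3 * kerr_p y) (- 3 * kerr_p y) (kerr_v y)"

interpretation moving_frame "kerr_domain a \<Lambda> m \<sigma>" "kerr_ds_metric a \<Lambda> m"
  "\<lambda>A i y. kerr_e a y $ A $ i" "\<lambda>i A y. kerr_E a y $ i $ A"
  "\<lambda>A y. kerr_h a \<Lambda> m y $ A" "\<lambda>A B C y. kerr_\<gamma> a \<Lambda> m y $ A $ B $ C" "\<lambda>A B C D y. kerr_d\<gamma> a \<Lambda> m D y $ A $ B $ C"
  "\<lambda>A i k y. kerr_de a k y $ A $ i" "\<lambda>A i k l y. kerr_dde a k l y $ A $ i"
  by (rule kerr_moving_frame)

context
  fixes y :: "real^4"
  assumes y: "y \<in> kerr_domain a \<Lambda> m \<sigma>"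
begin

lemma kerr_h_duality:
  defines "c \<equiv> \<lambda>A. 1 / kerr_h a \<Lambda> m y $ A"
  shows "kerr_h a \<Lambda> m y $ 2 = - c 1" "kerr_h a \<Lambda> m y $ 4 = c 3" "c 2 = - kerr_h a \<Lambda> m y $ 1" "c 4 = kerr_h a \<Lambda> m y $ 3"
    "kerr_h a \<Lambda> m y $ 1 * c 1 = 1" "kerr_h a \<Lambda> m y $ 3 * c 3 = 1"
  unfolding c_def kerr_h_def frame_norms_def vector_4_index using kerr_domainD[OF y] by (simp_all add: field_simps)

text \<open>The cosmological term is confined to the coefficient of \<open>wedge\<close>: in the two
  bivector coefficients it cancels, leaving \<open>3 * kerr_p\<close> and
  \<open>- 3 * kerr_p\<close>.\<close>

lemma kerr_decomp:
  "kerr_h a \<Lambda> m y $ A * curvature A B C D y = kerr_weyl y A B C D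
      + \<Lambda> / 3 * kerr_h a \<Lambda> m y $ A * kerr_h a \<Lambda> m y $ B * ((if A = C \<and> B = D then 1 else 0) - (if A = D \<and> B = C then 1 else 0))"
proof -
  let ?r = "y$2" and ?x = "cos (y$3)"
  let ?Q = "kerr_Q a \<Lambda> m ?r" and ?Q1 = "kerr_Q1 a \<Lambda> m ?r" and ?Q2 = "kerr_Q2 a \<Lambda> ?r"
  let ?Y = "kerr_Y a \<Lambda> ?x" and ?Y1 = "kerr_Y1 a \<Lambda> ?x" and ?Y2 = "kerr_Y2 a \<Lambda> ?x"
  let ?S = "kerr_rho2 a (y$2) (y$3)"
  note rels = kerr_rels[OF y]
  have "curvature A B C D y = frame_curvature a ?r ?x ?Q ?Q1 ?Q2 ?Y ?Y1 ?Y2 (inverse ?S) (inverse ?Q) (inverse ?Y) A B C D"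
    unfolding curvature_def unfolding frame_curvature_def kerr_\<gamma>_def kerr_d\<gamma>_def ..
  moreover note frame_curvature_type_D[OF rels, of A ?Q1 ?Q2 ?Y1 ?Y2 B C D]
  moreover have "?Q = a\<^sup>2 - 2 * m * ?r + ?r\<^sup>2 - (\<Lambda> / 3) * (a\<^sup>2 + ?r\<^sup>2) * ?r\<^sup>2"
    by (simp add: kerr_Q_def)
  moreover note curv_kerr_de_sitter[OF rels(1,4) this kerr_Q1_def kerr_Q2_def kerr_Y_def kerr_Y1_def kerr_Y2_def
      kerr_p_def kerr_v_def]
  ultimately have "kerr_h a \<Lambda> m y $ A * curvature A B C D y = type_D (($) (kerr_h a \<Lambda> m y)) (kerr_p y + \<Lambda> / 3)
      (2 * kerr_p y - \<Lambda> / 3 + (kerr_p y + \<Lambda> / 3)) (\<Lambda> / 3 - 2 * kerr_p y - (kerr_p y + \<Lambda> / 3)) (kerr_v y) A B C D"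
    unfolding kerr_h_def by simp
  also have "\<dots> = type_D (($) (kerr_h a \<Lambda> m y)) (kerr_p y + \<Lambda> / 3) (3 * kerr_p y) (- 3 * kerr_p y) (kerr_v y) A B C D"
    by simp
  finally show ?thesis
    unfolding kerr_weyl_def type_D_def wedge_def by (simp add: distrib_right mult.assoc)
qed

lemma kerr_traceless: "(\<Sum>A\<in>UNIV. kerr_weyl y A B A D / kerr_h a \<Lambda> m y $ A) = 0"
  using type_D_traceless[OF kerr_h_duality] unfolding kerr_weyl_def by (simp add: divide_inverse)

lemma kerr_weyl_change4: "weyl (kerr_ds_metric a \<Lambda> m) i j k l y = change4 (kerr_weyl y) (frame y) i j k l"
  by (rule weyl_einstein[OF y kerr_decomp kerr_traceless]) simp

lemma kerr_weyl_up_change4: "weyl_up (kerr_ds_metric a \<Lambda> m) i j k l y = change4 (kerr_weyl y) (coframe y) i j k l"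
  by (rule weyl_up_einstein[OF y kerr_decomp kerr_traceless]) simp

lemma kerr_I1: "inv_I1 (kerr_ds_metric a \<Lambda> m) y = 48 * ((kerr_p y)\<^sup>2 - (kerr_v y)\<^sup>2)"
  unfolding inv_I1_def kerr_weyl_change4 kerr_weyl_up_change4 change4_contract[OF frame_coframe[OF y]]
  unfolding kerr_weyl_def by (rule type_D_square[OF kerr_h_duality])

lemma det_kerr_e: "det (kerr_e a y) = sin (y$3) * kerr_rho2 a (y$2) (y$3)"
  unfolding det_4 kerr_e_def kerr_rho2_def vector_4_index by (simp add: power2_eq_square algebra_simps)

text \<open>The metric is the congruence of the diagonal matrix of norms by \<open>kerr_e\<close>,
  and the norms multiply to -1.\<close>

lemma det_kerr: "det (kerr_ds_metric a \<Lambda> m y) = - (det (kerr_e a y))\<^sup>2"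
proof -
  have "kerr_ds_metric a \<Lambda> m y = transpose (kerr_e a y) ** (\<chi> A i. kerr_h a \<Lambda> m y $ A * kerr_e a y $ A $ i)"
    by (simp add: vec_eq_iff metric[OF y] matrix_matrix_mult_def transpose_def mult_ac)
  moreover have "(\<chi> A i. kerr_h a \<Lambda> m y $ A * kerr_e a y $ A $ i) = (\<chi> A. kerr_h a \<Lambda> m y $ A *s kerr_e a y $ A)"
    by (simp add: vec_eq_iff)
  ultimately have "det (kerr_ds_metric a \<Lambda> m y) = det (kerr_e a y) * ((\<Prod>A\<in>UNIV. kerr_h a \<Lambda> m y $ A) * det (kerr_e a y))"
    by (simp add: det_mul det_transpose det_rows_mul)
  moreover have "(\<Prod>A\<in>UNIV. kerr_h a \<Lambda> m y $ A) = -1"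
    unfolding prod_4 using kerr_h_duality(1,2,5,6) by algebra
  ultimately show ?thesis
    by (simp add: power2_eq_square)
qed

text \<open>The square root becomes the absolute value of det e. Since det e is sin \<theta> times a
  positive factor, only its sign separates this from the symbol transported by the frame.\<close>

lemma levi_civita_kerr:
  "levi_civita (kerr_ds_metric a \<Lambda> m) i j k l y = sgn (sin (y$3)) * change4 eps (frame y) i j k l"
proof -
  have "kerr_rho2 a (y$2) (y$3) > 0"
    using kerr_domainD(1)[OF y] by (simp add: kerr_rho2_def less_le)
  then have "\<bar>det (kerr_e a y)\<bar> = sgn (sin (y$3)) * det (kerr_e a y)"
    unfolding det_kerr_e by (simp add: abs_mult abs_sgn sgn_mult mult_ac)
  moreover have "change4 eps (frame y) i j k l = det (kerr_e a y) * eps i j k l"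
    using eps_sum[of "frame y" k l i j] by (simp add: change4_def change2_def frame_def)
  ultimately show ?thesis
    unfolding levi_civita_def det_kerr eps_def[symmetric] by simp
qed

lemma kerr_weyl_dual_change4:
  "weyl_dual (kerr_ds_metric a \<Lambda> m) i j k l y = sgn (sin (y$3)) / 2 *
    change4 (\<lambda>A B C D. \<Sum>E\<in>UNIV. \<Sum>F\<in>UNIV. eps A B E F * kerr_weyl y E F C D
      * (1 / kerr_h a \<Lambda> m y $ E * (1 / kerr_h a \<Lambda> m y $ F))) (frame y) i j k l"
proof -
  have "(\<Sum>p\<in>UNIV. \<Sum>q\<in>UNIV. matrix_inv (kerr_ds_metric a \<Lambda> m y) $ s $ p * matrix_inv (kerr_ds_metric a \<Lambda> m y) $ u $ q
        * weyl (kerr_ds_metric a \<Lambda> m) p q k l y)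
      = change2 (change2 (\<lambda>A B. change2 (kerr_weyl y A B) (frame y) k l) (frame y))
          (\<lambda>p s. matrix_inv (kerr_ds_metric a \<Lambda> m y) $ s $ p) s u" for s u
    unfolding kerr_weyl_change4 change4_def change2_def[of "change2 _ _"] by (simp add: mult_ac)
  also have "\<dots> s u = change2 (\<lambda>A B. change2 (kerr_weyl y A B) (frame y) k l) (coframe y) s u" for s u
    unfolding change2_compose frame_raise[OF y] ..
  finally have "weyl_dual (kerr_ds_metric a \<Lambda> m) i j k l y = (1/2) * (\<Sum>s\<in>UNIV. \<Sum>u\<in>UNIV.
      sgn (sin (y$3)) * (change4 eps (frame y) i j s u * change2 (\<lambda>A B. change2 (kerr_weyl y A B) (frame y) k l) (coframe y) s u))"
    unfolding weyl_dual_def levi_civita_kerr by (simp add: mult.assoc)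
  then show ?thesis
    unfolding sum_distrib_left[symmetric] change4_dual[OF frame_coframe[OF y]] by simp
qed

lemma kerr_I2: "inv_I2 (kerr_ds_metric a \<Lambda> m) y = 96 * sgn (sin (y$3)) * kerr_p y * kerr_v y"
proof -
  have "inv_I2 (kerr_ds_metric a \<Lambda> m) y = sgn (sin (y$3)) / 2 * (192 * kerr_p y * kerr_v y)"
    unfolding inv_I2_def kerr_weyl_dual_change4 kerr_weyl_up_change4 mult.assoc[of "_ / 2"] sum_distrib_left[symmetric]
      change4_contract[OF frame_coframe[OF y]]
    unfolding kerr_weyl_def type_D_dual[OF kerr_h_duality] ..
  then show ?thesis by simp
qed

end

end

section \<open>Gradients of I_1 and I_2 and their Gram determinant\<close>

context
  fixes a \<Lambda> m \<sigma> :: real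
begin

text \<open>The derivatives of \<open>kerr_p\<close> and \<open>kerr_v\<close> with respect to \<open>r\<close>; those with respect to \<open>cos \<theta>\<close> are
  \<open>- a * kerr_vr\<close> and \<open>a * kerr_pr\<close>.\<close>

definition kerr_pr :: "real^4 \<Rightarrow> real" where
  "kerr_pr y = 3 * m * ((y$2)^4 - 6 * (y$2)^2 * (a * cos (y$3))^2 + (a * cos (y$3))^4) * inverse (kerr_rho2 a (y$2) (y$3)) ^ 4"

definition kerr_vr :: "real^4 \<Rightarrow> real" where
  "kerr_vr y = - 3 * m * (4 * (y$2)^3 * (a * cos (y$3)) - 4 * (y$2) * (a * cos (y$3))^3) * inverse (kerr_rho2 a (y$2) (y$3)) ^ 4"

interpretation moving_frame "kerr_domain a \<Lambda> m \<sigma>" "kerr_ds_metric a \<Lambda> m"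
  "\<lambda>A i y. kerr_e a y $ A $ i" "\<lambda>i A y. kerr_E a y $ i $ A"
  "\<lambda>A y. kerr_h a \<Lambda> m y $ A" "\<lambda>A B C y. kerr_\<gamma> a \<Lambda> m y $ A $ B $ C" "\<lambda>A B C D y. kerr_d\<gamma> a \<Lambda> m D y $ A $ B $ C"
  "\<lambda>A i k y. kerr_de a k y $ A $ i" "\<lambda>A i k l y. kerr_dde a k l y $ A $ i"
  by (rule kerr_moving_frame)

context
  fixes y :: "real^4"
  assumes y: "y \<in> kerr_domain a \<Lambda> m \<sigma>"
begin

text \<open>With z = r - i a x, \<open>kerr_p\<close> - i \<open>kerr_v\<close> is -m/z^3 and its
  derivative 3m/z^4 is \<open>kerr_pr\<close> - i \<open>kerr_vr\<close>. Differentiation by x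
  multiplies this by -i a, which exchanges the two parts.\<close>

lemma
  defines "rk k \<equiv> (if k = 2 then 1 else 0)" and "xk k \<equiv> (if k = 3 then - sin (y$3) else 0)"
  shows kerr_p_partial: "has_partial k (kerr_p a m) (rk k * kerr_pr y - xk k * a * kerr_vr y) y"
    and kerr_v_partial: "has_partial k (kerr_v a m) (rk k * kerr_vr y + xk k * a * kerr_pr y) y"
proof -
  note P = kerr_partials[OF y, of k, folded rk_def xk_def]
  define r where "r = y$2"
  define \<theta> where "\<theta> = y$3"
  define x where "x = cos \<theta>"
  define S where "S = kerr_rho2 a r \<theta>"
  define iS where "iS = inverse S"
  note fold = r_def[symmetric] \<theta>_def[symmetric] x_def[symmetric] S_def[symmetric] iS_def[symmetric]
  have iS: "S * iS = 1" and S: "S = r\<^sup>2 + a\<^sup>2 * x\<^sup>2"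
    using kerr_rels(1,4)[OF y] unfolding fold by auto
  have iS2: "iS^2 = S * iS^3" and iS3: "iS^3 = S * iS^4"
    using iS by algebra+
  show "has_partial k (kerr_p a m) (rk k * kerr_pr y - xk k * a * kerr_vr y) y"
    unfolding kerr_p_def[abs_def]
    by (rule has_partial_eqI, (rule P(1,2,8) has_partial_power has_partial_intros)+,
        unfold kerr_pr_def kerr_vr_def fold, simp add: iS2, use iS3 S in algebra)
  show "has_partial k (kerr_v a m) (rk k * kerr_vr y + xk k * a * kerr_pr y) y"
    unfolding kerr_v_def[abs_def]
    by (rule has_partial_eqI, (rule P(1,2,8) has_partial_power has_partial_intros)+,
        unfold kerr_pr_def kerr_vr_def fold, simp add: iS2, use iS3 S in algebra)
qed

text \<open>The squared moduli of m/z^3 and 3m/z^4, where |z|^2 is \<open>kerr_rho2\<close>.\<close>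

lemma kerr_p_v_norms:
  "(kerr_p a m y)\<^sup>2 + (kerr_v a m y)\<^sup>2 = m\<^sup>2 * inverse (kerr_rho2 a (y$2) (y$3)) ^ 3"
  "(kerr_pr y)\<^sup>2 + (kerr_vr y)\<^sup>2 = 9 * m\<^sup>2 * inverse (kerr_rho2 a (y$2) (y$3)) ^ 4"
proof -
  define r where "r = y$2"
  define \<theta> where "\<theta> = y$3"
  define x where "x = cos \<theta>"
  define S where "S = kerr_rho2 a r \<theta>"
  define iS where "iS = inverse S"
  note fold = r_def[symmetric] \<theta>_def[symmetric] x_def[symmetric] S_def[symmetric] iS_def[symmetric]
  have iS: "S * iS = 1" and S: "S = r\<^sup>2 + a\<^sup>2 * x\<^sup>2"
    using kerr_rels(1,4)[OF y] unfolding fold by auto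
  have iS3: "iS^3 = S^3 * iS^6" and iS4: "iS^4 = S^4 * iS^8"
    using iS by algebra+
  show "(kerr_p a m y)\<^sup>2 + (kerr_v a m y)\<^sup>2 = m\<^sup>2 * inverse (kerr_rho2 a (y$2) (y$3)) ^ 3"
    unfolding kerr_p_def kerr_v_def fold unfolding power_mult_distrib power_mult[symmetric]
    by (simp add: iS3 S) algebra
  show "(kerr_pr y)\<^sup>2 + (kerr_vr y)\<^sup>2 = 9 * m\<^sup>2 * inverse (kerr_rho2 a (y$2) (y$3)) ^ 4"
    unfolding kerr_pr_def kerr_vr_def fold unfolding power_mult_distrib power_mult[symmetric]
    by (simp add: iS4 S) algebra
qed

text \<open>The orientation sign is constant on the domain, so it is a mere factor when I_2 is
  differentiated.\<close>

lemma sgn_sin: "z \<in> kerr_domain a \<Lambda> m \<sigma> \<Longrightarrow> sgn (sin (z$3)) = sgn \<sigma>"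
  using kerr_domainD(6)[of z a \<Lambda> m \<sigma>] by (auto simp: zero_less_mult_iff)

lemma kerr_covec_k:
  "covec_k (kerr_ds_metric a \<Lambda> m) k y = - 96 * ((if k = 2 then kerr_p a m y * kerr_pr y - kerr_v a m y * kerr_vr y else 0)
     + (if k = 3 then a * sin (y$3) * (kerr_p a m y * kerr_vr y + kerr_v a m y * kerr_pr y) else 0))"
proof -
  have "has_partial k (\<lambda>y. 48 * ((kerr_p a m y)\<^sup>2 - (kerr_v a m y)\<^sup>2)) (96 * ((if k = 2 then kerr_p a m y * kerr_pr y - kerr_v a m y * kerr_vr y else 0)
     + (if k = 3 then a * sin (y$3) * (kerr_p a m y * kerr_vr y + kerr_v a m y * kerr_pr y) else 0))) y"
    by (rule has_partial_eqI, (rule kerr_p_partial kerr_v_partial has_partial_intros)+) (simp add: algebra_simps)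
  then have "has_partial k (inv_I1 (kerr_ds_metric a \<Lambda> m)) (96 * ((if k = 2 then kerr_p a m y * kerr_pr y - kerr_v a m y * kerr_vr y else 0)
     + (if k = 3 then a * sin (y$3) * (kerr_p a m y * kerr_vr y + kerr_v a m y * kerr_pr y) else 0))) y"
    by (subst has_partial_cong_open[OF open_domain y kerr_I1])
  from has_partial_imp_partial_deriv[OF this] show ?thesis
    unfolding covec_k_def by simp
qed

lemma kerr_covec_l:
  "covec_l (kerr_ds_metric a \<Lambda> m) k y = 96 * sgn \<sigma> * ((if k = 3 then a * sin (y$3) * (kerr_p a m y * kerr_pr y - kerr_v a m y * kerr_vr y) else 0)
     - (if k = 2 then kerr_p a m y * kerr_vr y + kerr_v a m y * kerr_pr y else 0))"
proof -
  have "has_partial k (\<lambda>y. 96 * sgn \<sigma> * kerr_p a m y * kerr_v a m y) (- 96 * sgn \<sigma> * ((if k = 3 then a * sin (y$3) * (kerr_p a m y * kerr_pr y - kerr_v a m y * kerr_vr y) else 0)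
     - (if k = 2 then kerr_p a m y * kerr_vr y + kerr_v a m y * kerr_pr y else 0))) y"
    by (rule has_partial_eqI, (rule kerr_p_partial kerr_v_partial has_partial_intros)+) (simp add: algebra_simps)
  moreover have "inv_I2 (kerr_ds_metric a \<Lambda> m) z = 96 * sgn \<sigma> * kerr_p a m z * kerr_v a m z" if "z \<in> kerr_domain a \<Lambda> m \<sigma>" for z
    using kerr_I2[OF that] sgn_sin[OF that] by simp
  ultimately have "has_partial k (inv_I2 (kerr_ds_metric a \<Lambda> m)) (- 96 * sgn \<sigma> * ((if k = 3 then a * sin (y$3) * (kerr_p a m y * kerr_pr y - kerr_v a m y * kerr_vr y) else 0)
     - (if k = 2 then kerr_p a m y * kerr_vr y + kerr_v a m y * kerr_pr y else 0))) y"
    by (subst has_partial_cong_open[OF open_domain y])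
  from has_partial_imp_partial_deriv[OF this] show ?thesis
    unfolding covec_l_def by simp
qed

text \<open>I_1 and I_2 depend on r and \<theta> only, so only the diagonal block of the inverse
  metric in these coordinates matters; there the sin^2 \<theta> in Y cancels against the square of
  the dual vector.\<close>

lemma kerr_covec_inner:
  assumes "v 1 y = 0" "v 4 y = 0" "w 1 y = 0" "w 4 y = 0"
  shows "covec_inner (kerr_ds_metric a \<Lambda> m) v w y = inverse (kerr_rho2 a (y$2) (y$3)) *
     (kerr_Q a \<Lambda> m (y$2) * v 2 y * w 2 y + kerr_P a \<Lambda> (y$3) * v 3 y * w 3 y)"
proof -
  note d = kerr_domainD[OF y]
  have i: "matrix_inv (kerr_ds_metric a \<Lambda> m y) $ 2 $ 2 = kerr_Q a \<Lambda> m (y$2) * inverse (kerr_rho2 a (y$2) (y$3))"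
    "matrix_inv (kerr_ds_metric a \<Lambda> m y) $ 3 $ 3 = kerr_P a \<Lambda> (y$3) * inverse (kerr_rho2 a (y$2) (y$3))"
    "matrix_inv (kerr_ds_metric a \<Lambda> m y) $ 2 $ 3 = 0" "matrix_inv (kerr_ds_metric a \<Lambda> m y) $ 3 $ 2 = 0"
    unfolding matrix_inv_metric[OF y] sum_4 kerr_E_def kerr_h_def frame_norms_def vector_4_index
    using d(1-4) by (simp_all add: d(5) field_simps power2_eq_square)
  show ?thesis
    unfolding covec_inner_def sum_4 assms i by (simp add: algebra_simps)
qed

lemma kerr_Q2:
  assumes "m \<noteq> 0" "\<sigma> \<noteq> 0"
  shows "inv_Q2 (kerr_ds_metric a \<Lambda> m) y =
    a\<^sup>2 * (sin (y$3))\<^sup>2 * kerr_Q a \<Lambda> m (y$2) * kerr_P a \<Lambda> (y$3) / (kerr_rho2 a (y$2) (y$3) * m\<^sup>2)"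
proof -
  define p where "p = kerr_p a m y"
  define v where "v = kerr_v a m y"
  define p' where "p' = kerr_pr y"
  define v' where "v' = kerr_vr y"
  define S where "S = kerr_rho2 a (y$2) (y$3)"
  define Q where "Q = kerr_Q a \<Lambda> m (y$2)"
  define P where "P = kerr_P a \<Lambda> (y$3)"
  define s where "s = sin (y$3)"
  define iS where "iS = inverse S"
  note fold = p_def[symmetric] v_def[symmetric] p'_def[symmetric] v'_def[symmetric] S_def[symmetric]
     Q_def[symmetric] P_def[symmetric] s_def[symmetric] iS_def[symmetric]
  have pv: "p\<^sup>2 + v\<^sup>2 = m\<^sup>2 * iS ^ 3" and pv': "p'\<^sup>2 + v'\<^sup>2 = 9 * m\<^sup>2 * iS ^ 4"
    using kerr_p_v_norms unfolding fold by auto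
  have S: "S > 0"
    using kerr_domainD(1)[OF y] unfolding S_def by (simp add: kerr_rho2_def less_le)
  have \<sigma>: "(sgn \<sigma>)\<^sup>2 = 1"
    using assms(2) by (simp add: sgn_if)
  \<comment> \<open>\<alpha> - i \<beta> is the product of the complex numbers p - i v and p' - i
    v'; its squared modulus is therefore the product of the two known ones.\<close>
  define \<alpha> where "\<alpha> = p * p' - v * v'"
  define \<beta> where "\<beta> = p * v' + v * p'"
  have ab: "\<alpha>\<^sup>2 + \<beta>\<^sup>2 = 9 * m^4 * iS^7"
  proof -
    have "\<alpha>\<^sup>2 + \<beta>\<^sup>2 = (p\<^sup>2 + v\<^sup>2) * (p'\<^sup>2 + v'\<^sup>2)"
      unfolding \<alpha>_def \<beta>_def by algebra
    then show ?thesis unfolding pv pv' by algebra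
  qed
  note inner = kerr_covec_inner[unfolded fold]
  have k: "covec_k (kerr_ds_metric a \<Lambda> m) 1 y = 0" "covec_k (kerr_ds_metric a \<Lambda> m) 4 y = 0"
    "covec_k (kerr_ds_metric a \<Lambda> m) 2 y = - 96 * \<alpha>" "covec_k (kerr_ds_metric a \<Lambda> m) 3 y = - 96 * a * s * \<beta>"
    unfolding kerr_covec_k fold \<alpha>_def[symmetric] \<beta>_def[symmetric] by simp_all
  have l: "covec_l (kerr_ds_metric a \<Lambda> m) 1 y = 0" "covec_l (kerr_ds_metric a \<Lambda> m) 4 y = 0"
    "covec_l (kerr_ds_metric a \<Lambda> m) 2 y = - 96 * sgn \<sigma> * \<beta>" "covec_l (kerr_ds_metric a \<Lambda> m) 3 y = 96 * sgn \<sigma> * a * s * \<alpha>"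
    unfolding kerr_covec_l fold \<alpha>_def[symmetric] \<beta>_def[symmetric] by simp_all
  \<comment> \<open>Lagrange's identity: in a plane the Gram determinant is the determinant of the
    inverse metric times the squared 2 x 2 determinant of the covectors. By the Cauchy-Riemann
    equations the latter is a multiple of \<alpha>^2 + \<beta>^2.\<close>
  have "inv_I5 (kerr_ds_metric a \<Lambda> m) y * inv_I6 (kerr_ds_metric a \<Lambda> m) y - (inv_I7 (kerr_ds_metric a \<Lambda> m) y)\<^sup>2
      = iS\<^sup>2 * Q * P * (96 * 96 * sgn \<sigma> * a * s * (\<alpha>\<^sup>2 + \<beta>\<^sup>2))\<^sup>2"
    unfolding inv_I5_def inv_I6_def inv_I7_def inner[of "covec_k (kerr_ds_metric a \<Lambda> m)" "covec_k (kerr_ds_metric a \<Lambda> m)", OF k(1,2) k(1,2)] inner[of "covec_l (kerr_ds_metric a \<Lambda> m)" "covec_l (kerr_ds_metric a \<Lambda> m)", OF l(1,2) l(1,2)] inner[of "covec_k (kerr_ds_metric a \<Lambda> m)" "covec_l (kerr_ds_metric a \<Lambda> m)", OF k(1,2) l(1,2)] k l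
    by algebra
  also have "\<dots> = 96^4 * 81 * (sgn \<sigma>)\<^sup>2 * (Q * P * a\<^sup>2 * s\<^sup>2 * m^8 * iS^16)"
    unfolding ab by algebra
  finally have num: "inv_I5 (kerr_ds_metric a \<Lambda> m) y * inv_I6 (kerr_ds_metric a \<Lambda> m) y - (inv_I7 (kerr_ds_metric a \<Lambda> m) y)\<^sup>2
      = 96^4 * 81 * (Q * P * a\<^sup>2 * s\<^sup>2 * m^8 * iS^16)"
    unfolding \<sigma> by simp
  have "(inv_I1 (kerr_ds_metric a \<Lambda> m) y)\<^sup>2 + (inv_I2 (kerr_ds_metric a \<Lambda> m) y)\<^sup>2
      = 48\<^sup>2 * ((p\<^sup>2 - v\<^sup>2)\<^sup>2 + 4 * (sgn \<sigma>)\<^sup>2 * p\<^sup>2 * v\<^sup>2)"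
    unfolding kerr_I1[OF y] kerr_I2[OF y] sgn_sin[OF y] unfolding fold by algebra
  also have "\<dots> = (48 * (p\<^sup>2 + v\<^sup>2))\<^sup>2"
    unfolding \<sigma> by algebra
  finally have "(inv_I1 (kerr_ds_metric a \<Lambda> m) y)\<^sup>2 + (inv_I2 (kerr_ds_metric a \<Lambda> m) y)\<^sup>2 = (48 * m\<^sup>2 * iS^3)\<^sup>2"
    unfolding pv by (simp add: mult.assoc)
  moreover have pos: "48 * m\<^sup>2 * iS^3 > 0"
    using S assms(1) unfolding iS_def by simp
  \<comment> \<open>Positivity of the base lets the power 5/2 undo the square, leaving an integer
    exponent.\<close>
  then have "((48 * m\<^sup>2 * iS^3)\<^sup>2) powr (5/2) = (48 * m\<^sup>2 * iS^3) ^ 5"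
    by (simp add: powr_powr powr_realpow[symmetric] del: powr_numeral)
  ultimately have den: "((inv_I1 (kerr_ds_metric a \<Lambda> m) y)\<^sup>2 + (inv_I2 (kerr_ds_metric a \<Lambda> m) y)\<^sup>2) powr (5/2)
      = (48 * m\<^sup>2 * iS^3) ^ 5"
    by simp
  have "inv_Q2 (kerr_ds_metric a \<Lambda> m) y = (1/27) * (96^4 * 81 * (Q * P * a\<^sup>2 * s\<^sup>2 * m^8 * iS^16) / (48 * m\<^sup>2 * iS^3) ^ 5)"
    unfolding inv_Q2_def num den ..
  \<comment> \<open>The constants cancel: 96^4 * 81 = 27 * 48^5.\<close>
  also have "\<dots> = a\<^sup>2 * s\<^sup>2 * Q * P / (S * m\<^sup>2)"
    using S assms(1) unfolding iS_def by (simp add: field_simps power_mult_distrib eval_nat_numeral)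
  finally show ?thesis
    unfolding fold .
qed

end

end

theorem corollary49:
  fixes a \<Lambda> m t r \<theta> \<phi> :: real
  assumes "m \<noteq> 0"
    and "kerr_rho2 a r \<theta> \<noteq> 0"
    and "kerr_Q a \<Lambda> m r \<noteq> 0"
    and "kerr_P a \<Lambda> \<theta> > 0"
    and "sin \<theta> \<noteq> 0"
  shows "inv_Q2 (kerr_ds_metric a \<Lambda> m) (vector [t, r, \<theta>, \<phi>]) =
    - (a\<^sup>2 * (sin \<theta>)\<^sup>2
        * (r ^ 4 * \<Lambda> / 3 + (- 1 + a\<^sup>2 * \<Lambda> / 3) * r\<^sup>2 + 2 * m * r - a\<^sup>2)
        * (1 + a\<^sup>2 * \<Lambda> * (cos \<theta>)\<^sup>2 / 3))
      / ((r\<^sup>2 + a\<^sup>2 * (cos \<theta>)\<^sup>2) * m\<^sup>2)"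
proof -
  \<comment> \<open>Taking sin \<theta> itself for the sign parameter turns the orientation
    condition into sin^2 \<theta> > 0.\<close>
  have "vector [t, r, \<theta>, \<phi>] \<in> kerr_domain a \<Lambda> m (sin \<theta>)"
    using assms by (simp add: kerr_domain_def vector_4_index power2_eq_square[symmetric])
  from kerr_Q2[OF this assms(1,5)] have "inv_Q2 (kerr_ds_metric a \<Lambda> m) (vector [t, r, \<theta>, \<phi>]) =
      a\<^sup>2 * (sin \<theta>)\<^sup>2 * kerr_Q a \<Lambda> m r * kerr_P a \<Lambda> \<theta> / (kerr_rho2 a r \<theta> * m\<^sup>2)"
    unfolding vector_4_index .
  moreover have "kerr_Q a \<Lambda> m r = - (r ^ 4 * \<Lambda> / 3 + (- 1 + a\<^sup>2 * \<Lambda> / 3) * r\<^sup>2 + 2 * m * r - a\<^sup>2)"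
    by (simp add: kerr_Q_def field_simps eval_nat_numeral)
  moreover have "kerr_P a \<Lambda> \<theta> = 1 + a\<^sup>2 * \<Lambda> * (cos \<theta>)\<^sup>2 / 3"
    by (simp add: kerr_P_def)
  ultimately show ?thesis
    by (simp only: kerr_rho2_def mult_minus_left mult_minus_right)
qed

end
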